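(* Let $k$ be an uncountable algebraically closed field of characteristic $p>0$, $p\neq 2$, and let $R=k[[x_0,\dots,x_d]]/(f)$ be a $d$-dimensional singular (i.e. non-regular) hypersurface. Then $$\operatorname{e}_{HK}\Big(k[[x_0,\dots,x_d]]/\big(\textstyle\sum_{i=0}^d x_i^2\big)\Big)\le \operatorname{e}_{HK}(R).$$
   Context: For a $d$-dimensional Noetherian local ring $(A,\mathfrak m)$ of characteristic $p>0$, $\mathfrak m^{[q]}=(a^q:a\in\mathfrak m)$ for $q=p^e$, and $\operatorname{e}_{HK}(A)=\lim_{q\to\infty}\lambda(A/\mathfrak m^{[q]})/q^d$, where $\lambda$ denotes length. *)

theory Defs
  imports "HOL-Library.Countable_Set" "HOL-Computational_Algebra.Polynomial" Complex_Main
begin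

text \<open>Exponent vectors (monomials) in the variables x_0..x_d are functions nat => nat
  vanishing beyond d.  A power series is a coefficient function on exponent vectors;
  only its values on monomials in x_0..x_d matter.\<close>

type_synonym 'k pseries = "(nat \<Rightarrow> nat) \<Rightarrow> 'k"

definition mons :: "nat \<Rightarrow> (nat \<Rightarrow> nat) set" where
  "mons d = {\<alpha>. \<forall>i>d. \<alpha> i = 0}"

definition ps_eq :: "nat \<Rightarrow> 'k pseries \<Rightarrow> 'k pseries \<Rightarrow> bool" where
  "ps_eq d a b \<longleftrightarrow> (\<forall>\<alpha>\<in>mons d. a \<alpha> = b \<alpha>)"

definition ps_mult :: "'k::comm_ring_1 pseries \<Rightarrow> 'k pseries \<Rightarrow> 'k pseries" where
  "ps_mult a b = (\<lambda>\<alpha>. \<Sum>\<beta>\<in>{\<beta>. \<forall>i. \<beta> i \<le> \<alpha> i}. a \<beta> * b (\<lambda>i. \<alpha> i - \<beta> i))"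

definition ps_one :: "'k::comm_ring_1 pseries" where
  "ps_one = (\<lambda>\<alpha>. if \<alpha> = (\<lambda>_. 0) then 1 else 0)"

fun ps_pow :: "'k::comm_ring_1 pseries \<Rightarrow> nat \<Rightarrow> 'k pseries" where
  "ps_pow a 0 = ps_one"
| "ps_pow a (Suc n) = ps_mult a (ps_pow a n)"

definition ps_maxideal :: "'k::comm_ring_1 pseries set" where
  "ps_maxideal = {a. a (\<lambda>_. 0) = 0}"

text \<open>Membership of h in the ideal (f) + m^[q] of k[[x_0..x_d]], where
  m^[q] = (a^q : a in m).  This is the preimage of the Frobenius power of the maximal
  ideal of R = k[[x_0..x_d]]/(f).\<close>
definition in_frob_ideal :: "nat \<Rightarrow> 'k::comm_ring_1 pseries \<Rightarrow> nat \<Rightarrow> 'k pseries \<Rightarrow> bool" where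
  "in_frob_ideal d f q h \<longleftrightarrow>
     (\<exists>g n (r :: nat \<Rightarrow> 'k pseries) (a :: nat \<Rightarrow> 'k pseries).
        (\<forall>j<n. a j \<in> ps_maxideal) \<and>
        ps_eq d h (\<lambda>\<alpha>. ps_mult g f \<alpha> + (\<Sum>j<n. ps_mult (r j) (ps_pow (a j) q) \<alpha>)))"

text \<open>Length of R/m^[q] for R = k[[x_0..x_d]]/(f).  Since the residue field is k,
  the length equals the k-vector space dimension, i.e. the least number of elements
  spanning the quotient k[[x]]/((f)+m^[q]) over k.\<close>
definition hk_length :: "nat \<Rightarrow> 'k::field pseries \<Rightarrow> nat \<Rightarrow> nat" where
  "hk_length d f q = (LEAST n. \<exists>g :: nat \<Rightarrow> 'k pseries. \<forall>h :: 'k pseries. \<exists>c :: nat \<Rightarrow> 'k.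
       in_frob_ideal d f q (\<lambda>\<alpha>. h \<alpha> - (\<Sum>j<n. c j * g j \<alpha>)))"

definition e_HK :: "nat \<Rightarrow> nat \<Rightarrow> 'k::field pseries \<Rightarrow> real" where
  "e_HK p d f = lim (\<lambda>e. real (hk_length d f (p ^ e)) / real (p ^ e) ^ d)"

definition quadric :: "nat \<Rightarrow> 'k::comm_ring_1 pseries" where
  "quadric d = (\<lambda>\<alpha>. if \<exists>i\<le>d. \<alpha> = (\<lambda>j. if j = i then 2 else 0) then 1 else 0)"

definition mdeg :: "nat \<Rightarrow> (nat \<Rightarrow> nat) \<Rightarrow> nat" where
  "mdeg d \<alpha> = (\<Sum>i\<le>d. \<alpha> i)"

definition is_hypersurface :: "nat \<Rightarrow> 'k::comm_ring_1 pseries \<Rightarrow> bool" where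
  "is_hypersurface d f \<longleftrightarrow> f (\<lambda>_. 0) = 0 \<and> (\<exists>\<alpha>\<in>mons d. f \<alpha> \<noteq> 0)"

text \<open>The hypersurface is singular (non-regular) iff f lies in the square of the
  maximal ideal, i.e. all coefficients of total degree at most 1 vanish.\<close>
definition singular_hypersurface :: "nat \<Rightarrow> 'k::comm_ring_1 pseries \<Rightarrow> bool" where
  "singular_hypersurface d f \<longleftrightarrow> (\<forall>\<alpha>\<in>mons d. mdeg d \<alpha> \<le> 1 \<longrightarrow> f \<alpha> = 0)"

definition alg_closed :: "'k::field itself \<Rightarrow> bool" where
  "alg_closed _ \<longleftrightarrow> (\<forall>P :: 'k poly. degree P > 0 \<longrightarrow> (\<exists>x. poly P x = 0))"

end

theory Submission
  imports Defs "HOL-Library.Poly_Mapping" "HOL-Library.Function_Algebras" "HOL-Library.FuncSet"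
    "HOL-Computational_Algebra.Primes"
begin

text \<open>
  Modulo \<open>\<mm>\<^sup>[\<^sup>q\<^sup>]\<close> a power series only matters through its coefficients with all exponents below \<open>q\<close>, so
  the length \<open>\<lambda>\<^sub>q(f)\<close> is the codimension of the image of multiplication by \<open>f\<close> on the polynomials with
  exponents below \<open>q\<close>. By the filtration by powers of \<open>f\<close> and by flatness of Frobenius,
  \<open>p \<lambda>\<^sub>p\<^sub>q(f) \<ge> p\<^sup>d\<^sup>+\<^sup>1 \<lambda>\<^sub>q(f)\<close>; hence \<open>\<lambda>\<^sub>q(f) / q\<^sup>d\<close> increases with \<open>q\<close>, and it is bounded by division with
  respect to an initial monomial of \<open>f\<close>. So the limits exist, and it suffices that
  \<open>\<lambda>\<^sub>q(Q) \<le> \<lambda>\<^sub>q(f)\<close> for each \<open>q\<close>, where \<open>Q\<close> is the sum of squares.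

  For this adjoin a parameter \<open>s\<close> with \<open>s\<^sup>N = 0\<close>. As \<open>f\<close> lies in the square of the maximal ideal and \<open>2\<close>
  is invertible, Newton iteration yields coordinates \<open>y\<^sub>i \<equiv> x\<^sub>i (mod s)\<close> with \<open>Q + s f = \<Sum> y\<^sub>i\<^sup>2\<close>. Hence
  \<open>Q + s f\<close> has the same colength over the parameter as \<open>Q\<close>, namely \<open>N \<lambda>\<^sub>q(Q)\<close>, while reducing powers of
  \<open>s\<close> bounds this colength by \<open>N \<lambda>\<^sub>q(f) + q\<^sup>d\<^sup>+\<^sup>1\<close>. Let \<open>N\<close> tend to infinity.
\<close>

section \<open>Truncated polynomial algebras\<close>

type_synonym 'k mpol = "(nat \<Rightarrow> nat) \<Rightarrow>\<^sub>0 'k"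

abbreviation lookup :: "'k::zero mpol \<Rightarrow> 'k pseries" where
  "lookup \<equiv> Poly_Mapping.lookup"

abbreviation single :: "(nat \<Rightarrow> nat) \<Rightarrow> 'k \<Rightarrow> 'k::zero mpol" where
  "single \<equiv> Poly_Mapping.single"

abbreviation xmon :: "(nat \<Rightarrow> nat) \<Rightarrow> 'k::comm_ring_1 mpol" where
  "xmon \<alpha> \<equiv> single \<alpha> 1"

definition scl :: "'k::comm_ring_1 \<Rightarrow> 'k mpol \<Rightarrow> 'k mpol" where
  "scl c w = single 0 c * w"

text \<open>Evaluates the inner sum in the definition of the product: subtraction of exponents is
  truncated, so \<open>\<alpha> - \<beta>\<close> solves the equation only when
  \<open>\<beta> \<le> \<alpha>\<close>.\<close>

lemma Sum_any_shift:
  fixes G :: "'k::comm_monoid_add mpol"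
  shows "(\<Sum>q. lookup G q when \<alpha> = \<beta> + q) = (lookup G (\<alpha> - \<beta>) when \<beta> \<le> \<alpha>)"
proof (cases "\<beta> \<le> \<alpha>")
  case True
  have "(\<alpha> = \<beta> + q) = (q = \<alpha> - \<beta>)" for q
    using True by (auto simp: fun_eq_iff le_fun_def)
  then show ?thesis using True by simp
next
  case False
  have "\<alpha> \<noteq> \<beta> + q" for q using False by (auto simp: le_fun_def)
  then show ?thesis using False by simp
qed

lemma lookup_mult_sum:
  fixes F G :: "'k::comm_ring_1 mpol"
  assumes "finite {..\<alpha>}"
  shows "lookup (F * G) \<alpha> = (\<Sum>\<beta>\<in>{..\<alpha>}. lookup F \<beta> * lookup G (\<alpha> - \<beta>))"
proof -
  have "lookup (F * G) \<alpha> = (\<Sum>l. lookup F l * (lookup G (\<alpha> - l) when l \<le> \<alpha>))"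
    by (simp add: Poly_Mapping.lookup_mult Sum_any_shift)
  also have "\<dots> = (\<Sum>l\<in>{..\<alpha>}. lookup F l * (lookup G (\<alpha> - l) when l \<le> \<alpha>))"
    by (rule Sum_any.expand_superset) (use assms in \<open>auto simp: when_def split: if_splits\<close>)
  finally show ?thesis by (simp add: when_def)
qed

lemma lookup_scl [simp]: "lookup (scl c w) \<alpha> = c * lookup w \<alpha>"
  unfolding scl_def by (simp add: Poly_Mapping.map.rep_eq when_def flip: mult_map_scale_conv_mult)

lemma scl_mult_right: "scl c (v * w) = v * scl c w"
  by (simp add: scl_def algebra_simps)

lemma scl_xmon: "scl c (xmon \<alpha>) = single \<alpha> c"
  by (simp add: scl_def mult_single)

global_interpretation mp: vector_space "scl :: 'k::field \<Rightarrow> 'k mpol \<Rightarrow> 'k mpol"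
  by unfold_locales (simp_all add: scl_def algebra_simps single_add mult_single flip: mult.assoc)

section \<open>Truncation modulo monomial ideals\<close>

definition downset :: "(nat \<Rightarrow> nat) set \<Rightarrow> bool" where
  "downset D \<longleftrightarrow> finite D \<and> (\<forall>\<alpha>\<in>D. \<forall>\<beta>\<le>\<alpha>. \<beta> \<in> D)"

text \<open>Congruence modulo the monomial ideal spanned by the exponents outside \<open>D\<close>; for a downset
  \<open>D\<close> the quotient has the monomials in \<open>D\<close> as a basis.\<close>

definition eqm :: "(nat \<Rightarrow> nat) set \<Rightarrow> 'k::zero mpol \<Rightarrow> 'k mpol \<Rightarrow> bool" where
  "eqm D v w \<longleftrightarrow> (\<forall>\<alpha>\<in>D. lookup v \<alpha> = lookup w \<alpha>)"

definition trunc :: "(nat \<Rightarrow> nat) set \<Rightarrow> 'k pseries \<Rightarrow> 'k::comm_ring_1 mpol" where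
  "trunc D a = (\<Sum>\<alpha>\<in>D. single \<alpha> (a \<alpha>))"

lemma lookup_trunc: "finite D \<Longrightarrow> lookup (trunc D a) \<alpha> = (if \<alpha> \<in> D then a \<alpha> else 0)"
  by (simp add: trunc_def lookup_sum lookup_single when_def)

lemma downset_finite_atMost: "downset D \<Longrightarrow> \<alpha> \<in> D \<Longrightarrow> finite {..\<alpha>}"
  by (rule finite_subset[of _ D]) (auto simp: downset_def)

lemma eqm_refl [simp]: "eqm D v v"
  and eqm_sym: "eqm D v w \<Longrightarrow> eqm D w v"
  and eqm_trans [trans]: "eqm D u v \<Longrightarrow> eqm D v w \<Longrightarrow> eqm D u w"
  by (auto simp: eqm_def)

lemma eqm_add: "eqm D v w \<Longrightarrow> eqm D v' w' \<Longrightarrow> eqm D (v + v') (w + w')"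
  by (auto simp: eqm_def lookup_add)

lemma eqm_sum: "(\<And>i. i \<in> I \<Longrightarrow> eqm D (v i) (w i)) \<Longrightarrow> eqm D (\<Sum>i\<in>I. v i) (\<Sum>i\<in>I. w i)"
  by (auto simp: eqm_def lookup_sum intro!: sum.cong)

text \<open>A coefficient of a product at \<open>\<alpha>\<close> involves only coefficients of the
  factors at exponents below \<open>\<alpha>\<close>, and a downset contains all of these.\<close>

lemma eqm_mult:
  fixes v :: "'k::comm_ring_1 mpol"
  assumes D: "downset D" and "eqm D v w" "eqm D v' w'"
  shows "eqm D (v * v') (w * w')"
  unfolding eqm_def
proof
  fix \<alpha> assume \<alpha>: "\<alpha> \<in> D"
  have sub: "\<beta> \<in> D" if "\<beta> \<le> \<alpha>" for \<beta> using D \<alpha> that by (auto simp: downset_def)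
  have "\<alpha> - \<beta> \<in> D" for \<beta> by (rule sub) (simp add: le_fun_def)
  then show "lookup (v * v') \<alpha> = lookup (w * w') \<alpha>"
    using assms(2,3) sub
    by (auto simp: eqm_def lookup_mult_sum[OF downset_finite_atMost[OF D \<alpha>]] intro!: sum.cong)
qed

lemma eqm_mult_left:
  fixes v :: "'k::comm_ring_1 mpol"
  shows "downset D \<Longrightarrow> eqm D v w \<Longrightarrow> eqm D (u * v) (u * w)"
  by (simp add: eqm_mult)

lemma eqm_power:
  fixes v :: "'k::comm_ring_1 mpol"
  shows "downset D \<Longrightarrow> eqm D v w \<Longrightarrow> eqm D (v ^ n) (w ^ n)"
  by (induction n) (auto intro: eqm_mult)

lemma eqm_trunc: "finite D \<Longrightarrow> (\<And>\<alpha>. \<alpha> \<in> D \<Longrightarrow> lookup w \<alpha> = a \<alpha>) \<Longrightarrow> eqm D (trunc D a) w"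
  by (simp add: eqm_def lookup_trunc)

lemma eqm_single_zero: "\<alpha> \<notin> D \<Longrightarrow> eqm D (single \<alpha> c) 0"
  by (auto simp: eqm_def lookup_single when_def)

lemma sum_single_keys: "(\<Sum>\<alpha>\<in>Poly_Mapping.keys w. single \<alpha> (lookup w \<alpha>)) = w"
  by (rule poly_mapping_eqI) (auto simp: lookup_sum lookup_single when_def in_keys_iff)

lemma mpol_in_subspace:
  fixes U :: "'k::field mpol set"
  assumes "mp.subspace U" "\<And>\<alpha>. xmon \<alpha> \<in> U"
  shows "w \<in> U"
proof -
  have "(\<Sum>\<alpha>\<in>Poly_Mapping.keys w. scl (lookup w \<alpha>) (xmon \<alpha>)) \<in> U"
    using assms by (intro mp.subspace_sum mp.subspace_scale)
  then show ?thesis by (simp add: scl_xmon sum_single_keys)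
qed

text \<open>The elements that modulo \<open>F\<close> and the exponents outside \<open>D\<close> lie in the span of \<open>S\<close>. With
  \<open>F = 0\<close> this also expresses that an image is spanned by \<open>S\<close>.\<close>

definition cov :: "(nat \<Rightarrow> nat) set \<Rightarrow> 'k::field mpol \<Rightarrow> 'k mpol set \<Rightarrow> 'k mpol set" where
  "cov D F S = {w. \<exists>u\<in>mp.span S. \<exists>g. eqm D w (u + F * g)}"

lemma covI: "u \<in> mp.span S \<Longrightarrow> eqm D w (u + F * g) \<Longrightarrow> w \<in> cov D F S"
  by (auto simp: cov_def)

lemma subspace_cov: "mp.subspace (cov D F S)"
  unfolding mp.subspace_def
proof (intro conjI ballI allI)
  show "0 \<in> cov D F S"
    by (rule covI[of 0 _ _ _ _ 0]) (auto simp: mp.span_zero)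
next
  fix x y assume "x \<in> cov D F S" "y \<in> cov D F S"
  then obtain u g v h where "u \<in> mp.span S" "eqm D x (u + F * g)" "v \<in> mp.span S" "eqm D y (v + F * h)"
    by (auto simp: cov_def)
  then show "x + y \<in> cov D F S"
    by (intro covI[of "u + v" _ _ _ _ "g + h"] mp.span_add)
      (auto simp: eqm_def lookup_add algebra_simps)
next
  fix c x assume "x \<in> cov D F S"
  then obtain u g where "u \<in> mp.span S" "eqm D x (u + F * g)"
    by (auto simp: cov_def)
  then show "scl c x \<in> cov D F S"
    by (intro covI[of "scl c u" _ _ _ _ "scl c g"] mp.span_scale)
      (auto simp: eqm_def lookup_add algebra_simps simp flip: scl_mult_right)
qed

lemma cov_eqm: "w \<in> cov D F S \<Longrightarrow> eqm D v w \<Longrightarrow> v \<in> cov D F S"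
  unfolding cov_def using eqm_trans by blast

lemma span_subset_cov: "w \<in> mp.span S \<Longrightarrow> w \<in> cov D F S"
  by (rule covI[of w _ _ _ _ 0]) auto

lemma mult_in_cov: "F * g \<in> cov D F S"
  by (rule covI[of 0 _ _ _ _ g]) (auto simp: mp.span_zero)

lemma cov_eqm_mult: "eqm D w (F * g) \<Longrightarrow> w \<in> cov D F S"
  by (rule covI[of 0 _ _ _ _ g]) (auto simp: mp.span_zero)

text \<open>Monomials outside \<open>D\<close> are congruent to 0 and the covered elements form a
  subspace, so the monomials of \<open>D\<close> suffice.\<close>

lemma cov_UNIV:
  assumes "\<And>\<alpha>. \<alpha> \<in> D \<Longrightarrow> xmon \<alpha> \<in> cov D F S"
  shows "w \<in> cov D F S"
proof (rule mpol_in_subspace[OF subspace_cov])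
  fix \<alpha> show "xmon \<alpha> \<in> cov D F S"
    using assms by (cases "\<alpha> \<in> D")
      (auto intro: cov_eqm[OF _ eqm_single_zero] mp.subspace_0[OF subspace_cov])
qed

lemma mult_cov_UNIV:
  assumes "downset D" "\<And>\<alpha>. \<alpha> \<in> D \<Longrightarrow> F * xmon \<alpha> \<in> cov D G S"
  shows "F * w \<in> cov D G S"
proof -
  have "mp.subspace {w. F * w \<in> cov D G S}"
    using subspace_cov[of D G S] unfolding mp.subspace_def
    by (auto simp: algebra_simps simp flip: scl_mult_right)
  moreover have "xmon \<alpha> \<in> {w. F * w \<in> cov D G S}" for \<alpha>
  proof (cases "\<alpha> \<in> D")
    case False
    have "eqm D (F * xmon \<alpha>) (F * 0)"
      by (intro eqm_mult_left eqm_single_zero assms False)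
    then show ?thesis
      using cov_eqm[of "0" D G S] mp.subspace_0[OF subspace_cov[of D G S]] by simp
  qed (use assms in auto)
  ultimately show ?thesis using mpol_in_subspace by blast
qed

section \<open>Codimension of a principal ideal in the truncated algebra\<close>

definition tmult :: "(nat \<Rightarrow> nat) set \<Rightarrow> 'k::field mpol \<Rightarrow> 'k mpol set" where
  "tmult D F = range (\<lambda>g. trunc D (lookup (F * g)))"

text \<open>The codimension of the principal ideal generated by \<open>F\<close> in the truncated algebra. Upper bounds
  come from \<open>cod_le\<close> and lower bounds from \<open>cod_ge\<close>, in both cases by exhibiting a spanning set.\<close>

definition cod :: "(nat \<Rightarrow> nat) set \<Rightarrow> 'k::field mpol \<Rightarrow> nat" where
  "cod D F = card D - mp.dim (tmult D F)"

lemma trunc_eqm: "finite D \<Longrightarrow> trunc D (lookup v) = trunc D (lookup w) \<longleftrightarrow> eqm D v w"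
  unfolding poly_mapping_eq_iff by (auto simp: eqm_def lookup_trunc fun_eq_iff)

lemma trunc_add: "finite D \<Longrightarrow> trunc D (lookup (v + w)) = trunc D (lookup v) + trunc D (lookup w)"
  by (rule poly_mapping_eqI) (simp add: lookup_trunc lookup_add)

lemma trunc_scl: "finite D \<Longrightarrow> trunc D (lookup (scl c v)) = scl c (trunc D (lookup v))"
  by (rule poly_mapping_eqI) (simp add: lookup_trunc)

lemma trunc_zero: "trunc D (lookup 0) = 0"
  by (simp add: trunc_def)

lemma subspace_tmult: "finite D \<Longrightarrow> mp.subspace (tmult D F)"
  unfolding mp.subspace_def tmult_def
proof (intro conjI ballI allI)
  show "0 \<in> range (\<lambda>g. trunc D (lookup (F * g)))"
    by (rule range_eqI[of _ _ 0]) (simp add: trunc_zero)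
next
  fix x y assume "finite D" "x \<in> range (\<lambda>g. trunc D (lookup (F * g)))" "y \<in> range (\<lambda>g. trunc D (lookup (F * g)))"
  then show "x + y \<in> range (\<lambda>g. trunc D (lookup (F * g)))"
    by (auto simp flip: trunc_add distrib_left)
next
  fix c x assume "finite D" "x \<in> range (\<lambda>g. trunc D (lookup (F * g)))"
  then show "scl c x \<in> range (\<lambda>g. trunc D (lookup (F * g)))"
    by (auto simp: scl_mult_right simp flip: trunc_scl)
qed

lemma trunc_in_span: "trunc D a \<in> mp.span (xmon ` D)"
proof -
  have "(\<Sum>\<alpha>\<in>D. scl (a \<alpha>) (xmon \<alpha>)) \<in> mp.span (xmon ` D)"
    by (intro mp.span_sum mp.span_scale mp.span_base) auto
  then show ?thesis by (simp add: trunc_def scl_xmon)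
qed

lemma trunc_of_span_xmon:
  assumes "finite D" "w \<in> mp.span (xmon ` D)"
  shows "trunc D (lookup w) = w"
  using assms(2)
proof (rule mp.span_induct)
  show "mp.subspace {w. trunc D (lookup w) = w}"
    by (auto simp: mp.subspace_def trunc_zero trunc_add trunc_scl assms(1))
next
  fix x :: "'a mpol" assume "x \<in> xmon ` D"
  then show "trunc D (lookup x) = x"
    by (auto intro!: poly_mapping_eqI simp: lookup_trunc assms(1) lookup_single when_def)
qed

lemma trunc_span:
  assumes "finite D" "w \<in> mp.span S"
  shows "trunc D (lookup w) \<in> mp.span ((\<lambda>v. trunc D (lookup v)) ` S)"
  using assms(2)
proof (rule mp.span_induct)
  show "mp.subspace {w. trunc D (lookup w) \<in> mp.span ((\<lambda>v. trunc D (lookup v)) ` S)}"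
    by (auto simp: mp.subspace_def trunc_zero trunc_add trunc_scl assms(1) mp.span_zero
      intro: mp.span_add mp.span_scale)
qed (auto intro: mp.span_base)

lemma inj_on_xmon: "inj_on (xmon :: _ \<Rightarrow> 'k::comm_ring_1 mpol) D"
proof (rule inj_onI)
  fix \<alpha> \<beta> assume "(xmon \<alpha> :: 'k mpol) = xmon \<beta>"
  then have "lookup (xmon \<alpha> :: 'k mpol) \<alpha> = lookup (xmon \<beta>) \<alpha>" by simp
  then show "\<alpha> = \<beta>" by (auto simp: lookup_single when_def split: if_splits)
qed

lemma independent_xmon:
  assumes "finite D"
  shows "mp.independent (xmon ` D :: 'k::field mpol set)"
  unfolding mp.independent_explicit_finite_subsets
proof (intro allI impI ballI)
  fix A u and v :: "'k mpol"
  assume "A \<subseteq> xmon ` D" "finite A" "(\<Sum>v\<in>A. scl (u v) v) = 0" "v \<in> A"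
  then obtain E where E: "E \<subseteq> D" "A = xmon ` E" by (auto simp: subset_image_iff)
  then obtain \<alpha> where \<alpha>: "\<alpha> \<in> E" "v = xmon \<alpha>" using \<open>v \<in> A\<close> by auto
  have "finite E" using E assms finite_subset by blast
  have "0 = lookup (\<Sum>v\<in>A. scl (u v) v) \<alpha>" using \<open>_ = 0\<close> by simp
  also have "\<dots> = (\<Sum>\<beta>\<in>E. u (xmon \<beta>) * lookup (xmon \<beta>) \<alpha>)"
    by (simp add: E sum.reindex[OF inj_on_xmon] lookup_sum)
  also have "\<dots> = u (xmon \<alpha>)"
    using \<alpha> \<open>finite E\<close> by (simp add: lookup_single when_def if_distrib cong: if_cong)
  finally show "u v = 0" using \<alpha> by simp
qed

lemma tmult_basis:
  assumes "finite D"
  obtains B where "B \<subseteq> tmult D F" "mp.independent B" "tmult D F \<subseteq> mp.span B" "finite B"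
    "card B = mp.dim (tmult D F)" "card B \<le> card D"
proof -
  obtain B where B: "B \<subseteq> tmult D F" "mp.independent B" "tmult D F \<subseteq> mp.span B"
    "card B = mp.dim (tmult D F)"
    using mp.basis_exists[of "tmult D F"] by metis
  have "B \<subseteq> mp.span (xmon ` D)"
    using B(1) trunc_in_span by (auto simp: tmult_def)
  then have "finite B \<and> card B \<le> card (xmon ` D :: 'a mpol set)"
    using B(2) assms by (intro mp.independent_span_bound) auto
  then show ?thesis using that B by (simp add: card_image[OF inj_on_xmon])
qed

text \<open>Together with a basis of the image of \<open>F\<close>, the truncations of
  \<open>S\<close> span the independent set of all monomials in \<open>D\<close>, so
  \<open>card D\<close> is at most \<open>card S\<close> plus the rank.\<close>

lemma cod_le:
  assumes "finite D" "finite S" "\<And>w. w \<in> cov D F S"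
  shows "cod D F \<le> card S"
proof -
  obtain B where B: "tmult D F \<subseteq> mp.span B" "finite B" "card B = mp.dim (tmult D F)"
    using tmult_basis assms(1) by metis
  define S' where "S' = (\<lambda>v. trunc D (lookup v)) ` S"
  have "(xmon ` D :: 'a mpol set) \<subseteq> mp.span (S' \<union> B)"
  proof
    fix w :: "'a mpol" assume w: "w \<in> xmon ` D"
    then have tw: "trunc D (lookup w) = w"
      by (rule trunc_of_span_xmon[OF assms(1) mp.span_base])
    obtain u g where u: "u \<in> mp.span S" "eqm D w (u + F * g)"
      using assms(3)[of w] by (auto simp: cov_def)
    then have "w = trunc D (lookup u) + trunc D (lookup (F * g))"
      using tw trunc_eqm[of D w "u + F * g"] assms(1) by (simp add: trunc_add)
    moreover have "trunc D (lookup u) \<in> mp.span S'"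
      unfolding S'_def by (rule trunc_span) (use u assms in auto)
    moreover have "trunc D (lookup (F * g)) \<in> mp.span B"
      using B(1) by (auto simp: tmult_def)
    ultimately show "w \<in> mp.span (S' \<union> B)"
      using mp.span_add mp.span_mono[of S' "S' \<union> B"] mp.span_mono[of B "S' \<union> B"] by blast
  qed
  then have "card (xmon ` D :: 'a mpol set) \<le> card (S' \<union> B)"
    using mp.independent_span_bound[OF _ independent_xmon[OF assms(1)], of "S' \<union> B"] B(2) assms(2)
    by (simp add: S'_def)
  also have "\<dots> \<le> card S' + card B" by (rule card_Un_le)
  also have "card S' \<le> card S" unfolding S'_def by (rule card_image_le) fact
  finally show ?thesis by (simp add: cod_def B card_image[OF inj_on_xmon])
qed

text \<open>The bound of \<open>cod_le\<close> is attained: extend a basis \<open>B\<close> of the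
  image to a basis \<open>C\<close> of the whole truncated algebra and take
  \<open>C - B\<close>.\<close>

lemma cod_obtain:
  assumes "finite D"
  obtains S where "finite S" "card S = cod D F" "\<And>w. w \<in> cov D F S"
proof -
  obtain B where B: "B \<subseteq> tmult D F" "mp.independent B" "tmult D F \<subseteq> mp.span B" "finite B"
    "card B = mp.dim (tmult D F)" "card B \<le> card D"
    using tmult_basis assms(1) by metis
  have "B \<subseteq> mp.span (xmon ` D)"
    using B(1) trunc_in_span by (auto simp: tmult_def)
  then obtain C where C: "B \<subseteq> C" "C \<subseteq> mp.span (xmon ` D)" "mp.independent C" "mp.span (xmon ` D) \<subseteq> mp.span C"
    using B(2) mp.maximal_independent_subset_extend by metis
  have "card C = mp.dim (mp.span (xmon ` D :: 'a mpol set))"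
    by (rule mp.basis_card_eq_dim[OF C(2) C(4) C(3)])
  also have "\<dots> = card D"
    using mp.dim_eq_card_independent[OF independent_xmon[OF assms]]
    by (simp add: card_image[OF inj_on_xmon])
  finally have cC: "card C = card D" .
  have fC: "finite C" using C assms mp.independent_span_bound[of "xmon ` D" C] by auto
  show ?thesis
  proof
    show "finite (C - B)" using fC by auto
    show "card (C - B) = cod D F"
      using cC C(1) B by (simp add: cod_def card_Diff_subset)
    fix w
    have "trunc D (lookup w) \<in> mp.span ((C - B) \<union> B)"
      using trunc_in_span[of D "lookup w"] C by (auto simp: Un_absorb2)
    then obtain u v where uv: "u \<in> mp.span (C - B)" "v \<in> mp.span B" "trunc D (lookup w) = u + v"
      unfolding mp.span_Un by blast
    have "v \<in> tmult D F"
      using mp.span_minimal[OF B(1) subspace_tmult[OF assms]] uv by blast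
    then obtain g where g: "v = trunc D (lookup (F * g))" by (auto simp: tmult_def)
    have "eqm D w (u + F * g)"
      unfolding eqm_def
    proof
      fix \<alpha> assume "\<alpha> \<in> D"
      then have "lookup w \<alpha> = lookup (trunc D (lookup w)) \<alpha>" by (simp add: lookup_trunc assms)
      also have "\<dots> = lookup (u + F * g) \<alpha>"
        using \<open>\<alpha> \<in> D\<close> by (simp add: uv g lookup_add lookup_trunc assms)
      finally show "lookup w \<alpha> = lookup (u + F * g) \<alpha>" .
    qed
    then show "w \<in> cov D F (C - B)" using uv covI by blast
  qed
qed

text \<open>Covering with 0 in place of \<open>F\<close> says that \<open>S\<close> spans the image
  of \<open>F\<close>, which bounds the rank from above and hence the codimension from
  below.\<close>

lemma cod_ge:
  assumes "finite D" "finite S" "\<And>g. F * g \<in> cov D 0 S"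
  shows "card D \<le> cod D F + card S"
proof -
  define S' where "S' = (\<lambda>v. trunc D (lookup v)) ` S"
  have "tmult D F \<subseteq> mp.span S'"
  proof
    fix w assume "w \<in> tmult D F"
    then obtain g where g: "w = trunc D (lookup (F * g))" by (auto simp: tmult_def)
    obtain u where u: "u \<in> mp.span S" "eqm D (F * g) u"
      using assms(3)[of g] by (auto simp: cov_def)
    then have "w = trunc D (lookup u)" using g trunc_eqm[OF assms(1), of "F * g" u] by simp
    then show "w \<in> mp.span S'" using trunc_span[OF assms(1) u(1)] unfolding S'_def by simp
  qed
  then have "mp.dim (tmult D F) \<le> card S'" using assms(2) by (intro mp.dim_le_card) (auto simp: S'_def)
  also have "card S' \<le> card S" unfolding S'_def by (rule card_image_le) fact
  finally show ?thesis by (simp add: cod_def)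
qed

lemma rk_obtain:
  assumes "finite D"
  obtains S where "finite S" "card S + cod D F = card D" "\<And>g. F * g \<in> cov D 0 S"
proof -
  obtain B where B: "tmult D F \<subseteq> mp.span B" "finite B"
    "card B = mp.dim (tmult D F)" "card B \<le> card D"
    using tmult_basis assms(1) by metis
  have "F * g \<in> cov D 0 B" for g
  proof (rule covI)
    show "trunc D (lookup (F * g)) \<in> mp.span B" using B by (auto simp: tmult_def)
    show "eqm D (F * g) (trunc D (lookup (F * g)) + 0 * 0)"
      using assms by (simp add: eqm_def lookup_trunc)
  qed
  then show ?thesis using B by (intro that[of B]) (auto simp: cod_def)
qed

lemma cod_cong:
  assumes "downset D" "eqm D F G"
  shows "cod D F = cod D G"
proof -
  have "trunc D (lookup (F * g)) = trunc D (lookup (G * g))" for g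
    using assms by (subst trunc_eqm) (auto intro: eqm_mult simp: downset_def)
  then show ?thesis by (simp add: cod_def tmult_def)
qed

section \<open>Hilbert-Kunz lengths as codimensions\<close>

text \<open>The bounds vary with the variable because the deformation parameter later gets its own
  bound, and because slabs with one short side are counted in \<open>card_not_ge\<close>.\<close>

definition bx :: "nat \<Rightarrow> (nat \<Rightarrow> nat) \<Rightarrow> (nat \<Rightarrow> nat) set" where
  "bx m e = {\<alpha> \<in> mons m. \<forall>i\<le>m. \<alpha> i < e i}"

abbreviation box :: "nat \<Rightarrow> nat \<Rightarrow> (nat \<Rightarrow> nat) set" where
  "box d q \<equiv> bx d (\<lambda>_. q)"

definition uvec :: "nat \<Rightarrow> nat \<Rightarrow> nat" where
  "uvec i = (\<lambda>j. if j = i then 1 else 0)"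

lemma bij_betw_bx: "bij_betw (\<lambda>\<alpha>. restrict \<alpha> {..m}) (bx m e) (PiE {..m} (\<lambda>i. {..<e i}))"
proof (rule bij_betwI[where g = "\<lambda>\<phi> i. if i \<le> m then \<phi> i else 0"])
  show "(\<lambda>\<alpha>. restrict \<alpha> {..m}) \<in> bx m e \<rightarrow> (PiE {..m} (\<lambda>i. {..<e i}))"
    by (auto simp: bx_def)
  show "(\<lambda>\<phi> i. if i \<le> m then \<phi> i else 0) \<in> (PiE {..m} (\<lambda>i. {..<e i})) \<rightarrow> bx m e"
    by (auto simp: bx_def mons_def PiE_def Pi_def)
qed (auto simp: bx_def mons_def fun_eq_iff PiE_def extensional_def)

lemma finite_bx [simp]: "finite (bx m e)"
  using bij_betw_finite[OF bij_betw_bx[of m e]] by (simp add: finite_PiE)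

lemma card_bx: "card (bx m e) = (\<Prod>i\<le>m. e i)"
  using bij_betw_same_card[OF bij_betw_bx[of m e]] by (simp add: card_PiE)

lemma card_box: "card (box d q) = q ^ Suc d"
  by (simp add: card_bx)

lemma mons_down: "\<alpha> \<in> mons m \<Longrightarrow> \<beta> \<le> \<alpha> \<Longrightarrow> \<beta> \<in> mons m"
  by (simp add: mons_def le_fun_def) (metis le_zero_eq)

lemma downset_bx [simp]: "downset (bx m e)"
  unfolding downset_def
proof (intro conjI ballI allI impI)
  fix \<alpha> \<beta> assume "\<alpha> \<in> bx m e" "\<beta> \<le> \<alpha>"
  then show "\<beta> \<in> bx m e"
    using mons_down[of \<alpha> m \<beta>] by (auto simp: bx_def le_fun_def intro: le_less_trans)
qed simp

lemma finite_atMost_mons: "\<alpha> \<in> mons m \<Longrightarrow> finite {..\<alpha>}"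
  by (rule downset_finite_atMost[OF downset_bx[of m "\<lambda>i. Suc (\<alpha> i)"]]) (simp add: bx_def)

section \<open>Power series, their truncations and Frobenius powers of the maximal ideal\<close>

lemma ps_mult_eq: "ps_mult a b \<alpha> = (\<Sum>\<beta>\<in>{..\<alpha>}. a \<beta> * b (\<alpha> - \<beta>))"
  by (simp add: ps_mult_def atMost_def le_fun_def fun_diff_def)

lemma ps_mult_trunc:
  assumes "downset D" "\<alpha> \<in> D"
  shows "ps_mult a b \<alpha> = lookup (trunc D a * trunc D b) \<alpha>"
proof -
  have "\<beta> \<in> D" if "\<beta> \<le> \<alpha>" for \<beta> using assms that by (auto simp: downset_def)
  moreover have "\<alpha> - \<beta> \<le> \<alpha>" for \<beta> by (simp add: le_fun_def)
  moreover have "finite D" using assms by (simp add: downset_def)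
  ultimately show ?thesis
    unfolding lookup_mult_sum[OF downset_finite_atMost[OF assms]] ps_mult_eq
    by (intro sum.cong) (auto simp: lookup_trunc)
qed

lemma ps_pow_trunc:
  assumes "downset D" "\<alpha> \<in> D"
  shows "ps_pow a n \<alpha> = lookup (trunc D a ^ n) \<alpha>"
  using assms(2)
proof (induction n arbitrary: \<alpha>)
  case 0
  then show ?case by (simp add: ps_one_def lookup_one zero_fun_def when_def)
next
  case (Suc n)
  have fD: "finite D" using assms by (simp add: downset_def)
  have "ps_pow a (Suc n) \<alpha> = lookup (trunc D a * trunc D (ps_pow a n)) \<alpha>"
    using ps_mult_trunc[OF assms(1) Suc.prems] by simp
  moreover have "eqm D (trunc D a * trunc D (ps_pow a n)) (trunc D a * trunc D a ^ n)"
    using Suc.IH fD by (intro eqm_mult_left assms) (simp add: eqm_def lookup_trunc)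
  ultimately show ?case using Suc.prems by (simp add: eqm_def)
qed

lemma ps_pow_lookup:
  assumes "\<alpha> \<in> mons m"
  shows "ps_pow (lookup w) n \<alpha> = lookup (w ^ n) \<alpha>"
proof -
  \<comment> \<open>The smallest box that contains \<alpha>; only coefficients inside it affect the
    coefficient at \<alpha>.\<close>
  let ?D = "bx m (\<lambda>i. Suc (\<alpha> i))"
  have \<alpha>: "\<alpha> \<in> ?D" using assms by (simp add: bx_def)
  have "eqm ?D (trunc ?D (lookup w) ^ n) (w ^ n)"
    by (intro eqm_power eqm_trunc) auto
  then show ?thesis using ps_pow_trunc[OF downset_bx \<alpha>, of "lookup w" n] \<alpha> by (simp add: eqm_def)
qed

lemma single_power: "single \<alpha> c ^ n = single (\<lambda>i. n * \<alpha> i) (c ^ n :: 'k::comm_ring_1)"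
proof (induction n)
  case 0
  then show ?case by (simp flip: zero_fun_def)
next
  case (Suc n)
  have "\<alpha> + (\<lambda>i. n * \<alpha> i) = (\<lambda>i. Suc n * \<alpha> i)" by (auto simp: fun_eq_iff)
  then show ?case by (simp add: Suc mult_single)
qed

lemma CHAR_mpol: "CHAR('k::comm_ring_1 mpol) = CHAR('k)"
proof (rule CHAR_eqI)
  show "of_nat CHAR('k) = (0 :: 'k mpol)"
    by (simp flip: single_of_nat)
  fix n assume "of_nat n = (0 :: 'k mpol)"
  then have "lookup (single 0 (of_nat n :: 'k)) 0 = 0" by simp
  then show "CHAR('k) dvd n" by (simp add: of_nat_eq_0_iff_char_dvd del: single_of_nat)
qed

lemma frob_sum:
  fixes a :: "'i \<Rightarrow> 'k::comm_ring_1 mpol"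
  assumes "CHAR('k) = p" "prime p"
  shows "(\<Sum>i\<in>I. a i) ^ (p ^ e) = (\<Sum>i\<in>I. a i ^ (p ^ e))"
  using assms by (intro freshmans_dream_sum') (auto simp: CHAR_mpol)

lemma mult_not_in_box:
  assumes "\<alpha> \<in> mons d" "\<alpha> \<noteq> 0"
  shows "(\<lambda>i. q * \<alpha> i) \<notin> box d q"
proof -
  obtain i where i: "\<alpha> i \<noteq> 0" using assms by (auto simp: fun_eq_iff)
  then have "i \<le> d" using assms by (auto simp: mons_def not_less)
  moreover have "q \<le> q * \<alpha> i" using i by simp
  ultimately show ?thesis by (auto simp: bx_def not_less)
qed

text \<open>By the freshman's dream the power is the sum of the \<open>q\<close>-th powers of the
  terms. The constant term is zero, and every other exponent, multiplied by \<open>q\<close>, leaves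
  the box.\<close>

lemma maxideal_power_eqm:
  fixes a :: "'k::comm_ring_1 pseries"
  assumes "CHAR('k) = p" "prime p" "a \<in> ps_maxideal"
  shows "eqm (box d (p ^ e)) (trunc (box d (p ^ e)) a ^ (p ^ e)) 0"
proof -
  let ?q = "p ^ e" let ?D = "box d ?q"
  have q: "?q > 0" using assms by (simp add: prime_gt_0_nat)
  have "eqm ?D (single \<alpha> (a \<alpha>) ^ ?q) 0" if "\<alpha> \<in> ?D" for \<alpha>
  proof (cases "\<alpha> = 0")
    case True
    then have "a \<alpha> = 0" using assms(3) by (simp add: ps_maxideal_def zero_fun_def)
    then show ?thesis using q by (simp add: zero_power)
  next
    case False
    then show ?thesis unfolding single_power
      using that by (intro eqm_single_zero mult_not_in_box) (auto simp: bx_def)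
  qed
  then have "eqm ?D (\<Sum>\<alpha>\<in>?D. single \<alpha> (a \<alpha>) ^ ?q) (\<Sum>\<alpha>\<in>?D. 0)"
    by (intro eqm_sum)
  then show ?thesis by (simp add: trunc_def frob_sum[OF assms(1,2)])
qed

text \<open>Multiplication by the \<open>q\<close>-th power of a variable shifts exponents: a single
  summand of the convolution survives.\<close>

lemma ps_mult_var_pow:
  assumes "\<alpha> \<in> mons d"
  shows "ps_mult r (ps_pow (lookup (xmon (uvec j))) q) \<alpha> =
    (if q \<le> \<alpha> j then r (\<lambda>i. \<alpha> i - q * uvec j i) else (0 :: 'k::comm_ring_1))"
proof -
  let ?u = "\<lambda>i. q * uvec j i"
  have "ps_mult r (ps_pow (lookup (xmon (uvec j))) q) \<alpha>
      = (\<Sum>\<beta>\<in>{..\<alpha>}. r \<beta> * (if ?u = \<alpha> - \<beta> then 1 else 0))"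
    unfolding ps_mult_eq
  proof (rule sum.cong[OF refl])
    fix \<beta>
    have "\<alpha> - \<beta> \<in> mons d" using assms by (rule mons_down) (simp add: le_fun_def)
    then show "r \<beta> * ps_pow (lookup (xmon (uvec j))) q (\<alpha> - \<beta>) = r \<beta> * (if ?u = \<alpha> - \<beta> then 1 else 0)"
      by (simp add: ps_pow_lookup single_power lookup_single when_def)
  qed
  also have "\<dots> = (\<Sum>\<beta>\<in>{..\<alpha>}. if \<beta> = \<alpha> - ?u then (if q \<le> \<alpha> j then r \<beta> else 0) else 0)"
  proof (rule sum.cong[OF refl])
    fix \<beta> assume "\<beta> \<in> {..\<alpha>}"
    then have le: "\<beta> i \<le> \<alpha> i" for i by (simp add: le_fun_def)
    have "?u = \<alpha> - \<beta> \<longleftrightarrow> \<beta> = \<alpha> - ?u \<and> q \<le> \<alpha> j"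
    proof
      assume eq: "?u = \<alpha> - \<beta>"
      then have *: "?u i = \<alpha> i - \<beta> i" for i by (metis minus_apply)
      show "\<beta> = \<alpha> - ?u \<and> q \<le> \<alpha> j"
      proof
        show "\<beta> = \<alpha> - ?u"
        proof
          fix x show "\<beta> x = (\<alpha> - ?u) x" using *[of x] le[of x] by auto
        qed
        show "q \<le> \<alpha> j" using *[of j] by (simp add: uvec_def)
      qed
    next
      assume *: "\<beta> = \<alpha> - ?u \<and> q \<le> \<alpha> j"
      then have "?u i = \<alpha> i - \<beta> i" for i by (auto simp: uvec_def)
      then show "?u = \<alpha> - \<beta>" by (auto simp: fun_eq_iff)
    qed
    then show "r \<beta> * (if ?u = \<alpha> - \<beta> then 1 else 0) = (if \<beta> = \<alpha> - ?u then (if q \<le> \<alpha> j then r \<beta> else 0) else 0)"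
      by simp
  qed
  also have "\<dots> = (if q \<le> \<alpha> j then r (\<alpha> - ?u) else 0)"
    using finite_atMost_mons[OF assms] by (simp add: le_fun_def)
  finally show ?thesis by (simp add: fun_diff_def)
qed

text \<open>From left to right, \<open>q\<close>-th powers of elements of the maximal ideal vanish
  on the box. Conversely, a series vanishing on the box is a combination of the \<open>q\<close>-th
  powers of the variables, each with a power series as multiplier.\<close>

lemma in_frob_ideal_iff:
  fixes f h :: "'k::field pseries"
  assumes "CHAR('k) = p" "prime p"
  shows "in_frob_ideal d f (p ^ e) h \<longleftrightarrow>
    (\<exists>g. \<forall>\<alpha>\<in>box d (p ^ e). h \<alpha> = lookup (trunc (box d (p ^ e)) f * g) \<alpha>)"
    (is "?L \<longleftrightarrow> ?R")
proof
  let ?q = "p ^ e" let ?D = "box d ?q"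
  assume ?L
  then obtain g r a and n :: nat where a: "\<forall>j<n. a j \<in> ps_maxideal" and
    h: "ps_eq d h (\<lambda>\<alpha>. ps_mult g f \<alpha> + (\<Sum>j<n. ps_mult (r j) (ps_pow (a j) ?q) \<alpha>))"
    unfolding in_frob_ideal_def by (elim exE conjE) (rule that)
  have "h \<alpha> = lookup (trunc ?D f * trunc ?D g) \<alpha>" if \<alpha>: "\<alpha> \<in> ?D" for \<alpha>
  proof -
    have "ps_mult (r j) (ps_pow (a j) ?q) \<alpha> = 0" if "j < n" for j
    proof -
      have "eqm ?D (trunc ?D (ps_pow (a j) ?q)) (trunc ?D (a j) ^ ?q)"
        by (rule eqm_trunc) (auto simp: ps_pow_trunc[OF downset_bx])
      also have "eqm ?D \<dots> 0"
        using a that by (intro maxideal_power_eqm assms) auto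
      finally have "eqm ?D (trunc ?D (r j) * trunc ?D (ps_pow (a j) ?q)) (trunc ?D (r j) * 0)"
        by (intro eqm_mult_left) auto
      then show ?thesis using \<alpha> by (simp add: ps_mult_trunc[OF downset_bx \<alpha>] eqm_def)
    qed
    moreover have "\<alpha> \<in> mons d" using \<alpha> by (simp add: bx_def)
    ultimately show ?thesis
      using h by (simp add: ps_eq_def ps_mult_trunc[OF downset_bx \<alpha>, of g f] mult.commute)
  qed
  then show ?R by blast
next
  let ?q = "p ^ e" let ?D = "box d ?q"
  assume ?R
  then obtain g where g: "\<And>\<alpha>. \<alpha> \<in> ?D \<Longrightarrow> h \<alpha> = lookup (trunc ?D f * g) \<alpha>" by blast
  define h' where "h' = (\<lambda>\<alpha>. h \<alpha> - ps_mult (lookup g) f \<alpha>)"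
  have h'0: "h' \<alpha> = 0" if \<alpha>: "\<alpha> \<in> ?D" for \<alpha>
  proof -
    have "eqm ?D (trunc ?D (lookup g) * trunc ?D f) (g * trunc ?D f)"
      by (rule eqm_mult[OF downset_bx eqm_trunc eqm_refl]) auto
    then show ?thesis using \<alpha> g[OF \<alpha>]
      by (simp add: h'_def ps_mult_trunc[OF downset_bx \<alpha>] eqm_def mult.commute)
  qed
  \<comment> \<open>Every monomial outside the box is assigned to the first variable whose exponent
    is at least \<open>q\<close>. The multiplier \<open>r j\<close> collects the terms of
    \<open>h'\<close> assigned to variable \<open>j\<close>, divided by its \<open>q\<close>-th
    power, so that each term is counted exactly once.\<close>
  define r where "r = (\<lambda>j \<gamma>. if \<forall>i<j. \<gamma> i < ?q then h' (\<lambda>i. \<gamma> i + ?q * uvec j i) else 0)"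
  define a where "a = (\<lambda>j. lookup (xmon (uvec j) :: 'k mpol))"
  have key: "h' \<alpha> = (\<Sum>j<Suc d. ps_mult (r j) (ps_pow (a j) ?q) \<alpha>)" if \<alpha>: "\<alpha> \<in> mons d" for \<alpha>
  proof -
    have t: "ps_mult (r j) (ps_pow (a j) ?q) \<alpha> =
        (if ?q \<le> \<alpha> j \<and> (\<forall>i<j. \<alpha> i < ?q) then h' \<alpha> else 0)" for j
    proof (cases "?q \<le> \<alpha> j")
      case True
      have "(\<lambda>i. \<alpha> i - ?q * uvec j i + ?q * uvec j i) = \<alpha>"
        using True by (auto simp: fun_eq_iff uvec_def)
      moreover have "(\<forall>i<j. \<alpha> i - ?q * uvec j i < ?q) \<longleftrightarrow> (\<forall>i<j. \<alpha> i < ?q)"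
        by (auto simp: uvec_def)
      ultimately show ?thesis using True
        by (auto simp: a_def ps_mult_var_pow[OF \<alpha>] r_def)
    qed (simp add: a_def ps_mult_var_pow[OF \<alpha>])
    show ?thesis
    proof (cases "\<alpha> \<in> ?D")
      case True
      then have "\<not> ?q \<le> \<alpha> j" if "j < Suc d" for j using that by (simp add: bx_def not_le)
      then show ?thesis using h'0[OF True] by (simp add: t)
    next
      case False
      then have ex: "\<exists>i. i \<le> d \<and> ?q \<le> \<alpha> i" using \<alpha> by (auto simp: bx_def not_less)
      \<comment> \<open>The variable to which \<alpha> is assigned; all other summands vanish at
        \<alpha>.\<close>
      define i0 where "i0 = (LEAST i. i \<le> d \<and> ?q \<le> \<alpha> i)"
      have i0: "i0 \<le> d" "?q \<le> \<alpha> i0" using LeastI_ex[OF ex] by (auto simp: i0_def)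
      have min: "\<alpha> i < ?q" if "i < i0" for i
        using not_less_Least[of i "\<lambda>i. i \<le> d \<and> ?q \<le> \<alpha> i"] that i0(1) by (fastforce simp: i0_def)
      have "(?q \<le> \<alpha> j \<and> (\<forall>i<j. \<alpha> i < ?q)) \<longleftrightarrow> j = i0" if "j < Suc d" for j
        using i0 min by (metis linorder_neqE_nat not_le)
      then have "(\<Sum>j<Suc d. ps_mult (r j) (ps_pow (a j) ?q) \<alpha>) = (\<Sum>j<Suc d. if j = i0 then h' \<alpha> else 0)"
        by (intro sum.cong) (auto simp: t)
      also have "\<dots> = h' \<alpha>" using i0 by (subst sum.delta) auto
      finally show ?thesis by simp
    qed
  qed
  have "ps_eq d h (\<lambda>\<alpha>. ps_mult (lookup g) f \<alpha> + (\<Sum>j<Suc d. ps_mult (r j) (ps_pow (a j) ?q) \<alpha>))"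
    unfolding ps_eq_def by (metis (no_types, lifting) add.commute diff_add_cancel h'_def key)
  moreover have "a j \<in> ps_maxideal" for j
  proof -
    have "uvec j \<noteq> (\<lambda>_. 0)" by (auto simp: uvec_def fun_eq_iff)
    then show ?thesis by (auto simp: ps_maxideal_def a_def lookup_single when_def)
  qed
  ultimately show ?L unfolding in_frob_ideal_def by blast
qed

text \<open>By \<open>in_frob_ideal_iff\<close>, series span the quotient exactly when their
  truncations cover everything modulo \<open>?F\<close>. A minimal cover attains the length, and
  \<open>cod_le\<close> shows that no shorter family works.\<close>

lemma hk_length_eq_cod_trunc:
  fixes f :: "'k::field pseries"
  assumes "CHAR('k) = p" "prime p"
  shows "hk_length d f (p ^ e) = cod (box d (p ^ e)) (trunc (box d (p ^ e)) f)"
proof -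
  let ?D = "box d (p ^ e)"
  let ?F = "trunc ?D f"
  show ?thesis unfolding hk_length_def
  proof (rule Least_equality)
    obtain S where S: "finite S" "card S = cod ?D ?F" "\<And>w. w \<in> cov ?D ?F S"
      using cod_obtain[of ?D ?F] by auto
    obtain s where s: "bij_betw s {..<cod ?D ?F} S"
      using ex_bij_betw_nat_finite[OF S(1)] S(2) by (auto simp: atLeast0LessThan)
    have "\<exists>c. in_frob_ideal d f (p ^ e) (\<lambda>\<alpha>. h \<alpha> - (\<Sum>j<cod ?D ?F. c j * lookup (s j) \<alpha>))" for h
    proof -
      obtain u g where u: "u \<in> mp.span S" "eqm ?D (trunc ?D h) (u + ?F * g)"
        using S(3)[of "trunc ?D h"] by (auto simp: cov_def)
      obtain c where "u = (\<Sum>v\<in>S. scl (c v) v)"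
        using u(1) mp.span_finite[OF S(1)] by auto
      also have "\<dots> = (\<Sum>j<cod ?D ?F. scl (c (s j)) (s j))"
        by (rule sum.reindex_bij_betw[OF s, symmetric])
      finally have "h \<alpha> - (\<Sum>j<cod ?D ?F. c (s j) * lookup (s j) \<alpha>) = lookup (?F * g) \<alpha>"
        if "\<alpha> \<in> ?D" for \<alpha>
        using u(2) that by (simp add: eqm_def lookup_trunc lookup_add lookup_sum)
      then show ?thesis unfolding in_frob_ideal_iff[OF assms]
        by (intro exI[of _ "c \<circ> s"] exI[of _ g]) auto
    qed
    then show "\<exists>g. \<forall>h. \<exists>c. in_frob_ideal d f (p ^ e) (\<lambda>\<alpha>. h \<alpha> - (\<Sum>j<cod ?D ?F. c j * g j \<alpha>))"
      by (intro exI[of _ "\<lambda>j. lookup (s j)"]) auto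
  next
    fix n
    assume "\<exists>g :: nat \<Rightarrow> 'k pseries. \<forall>h. \<exists>c. in_frob_ideal d f (p ^ e) (\<lambda>\<alpha>. h \<alpha> - (\<Sum>j<n. c j * g j \<alpha>))"
    then obtain g where g: "\<And>h. \<exists>c. in_frob_ideal d f (p ^ e) (\<lambda>\<alpha>. h \<alpha> - (\<Sum>j<n. c j * g j \<alpha>))"
      by blast
    define S where "S = (\<lambda>j. trunc ?D (g j)) ` {..<n}"
    have "w \<in> cov ?D ?F S" for w
    proof -
      obtain c t where ct: "\<And>\<alpha>. \<alpha> \<in> ?D \<Longrightarrow>
          lookup w \<alpha> - (\<Sum>j<n. c j * g j \<alpha>) = lookup (?F * t) \<alpha>"
        using g[of "lookup w"] unfolding in_frob_ideal_iff[OF assms] by blast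
      have "(\<Sum>j<n. scl (c j) (trunc ?D (g j))) \<in> mp.span S"
        by (intro mp.span_sum mp.span_scale mp.span_base) (auto simp: S_def)
      moreover have "eqm ?D w ((\<Sum>j<n. scl (c j) (trunc ?D (g j))) + ?F * t)"
        using ct by (simp add: eqm_def lookup_add lookup_sum lookup_trunc algebra_simps)
      ultimately show ?thesis by (rule covI)
    qed
    then have "cod ?D ?F \<le> card S" by (intro cod_le) (auto simp: S_def)
    also have "card S \<le> n" using card_image_le[of "{..<n}"] by (fastforce simp: S_def)
    finally show "cod ?D ?F \<le> n" .
  qed
qed

text \<open>Any polynomial with the right coefficients in the box may represent \<open>f\<close>;
  this allows one polynomial for two values of \<open>q\<close>, or additional monomials.\<close>

lemma hk_length_eq_cod:
  fixes f :: "'k::field pseries"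
  assumes "CHAR('k) = p" "prime p" "\<And>\<alpha>. \<alpha> \<in> box d (p ^ e) \<Longrightarrow> lookup F \<alpha> = f \<alpha>"
  shows "hk_length d f (p ^ e) = cod (box d (p ^ e)) F"
  unfolding hk_length_eq_cod_trunc[OF assms(1,2)]
  by (intro cod_cong eqm_trunc) (auto simp: assms(3))

section \<open>Existence of the limit\<close>

lemma mult_span:
  assumes "u \<in> mp.span S"
  shows "F * u \<in> mp.span ((*) F ` S)"
  using assms
proof (rule mp.span_induct)
  show "mp.subspace {u. F * u \<in> mp.span ((*) F ` S)}"
    by (auto simp: mp.subspace_def mp.span_zero distrib_left simp flip: scl_mult_right
        intro: mp.span_add mp.span_scale)
qed (auto intro: mp.span_base)

text \<open>Filter the quotient by \<open>F * G\<close> with the ideal of \<open>F\<close>: the top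
  piece is the quotient by \<open>F\<close>, and multiplication by \<open>F\<close> maps the
  quotient by \<open>G\<close> onto the lower piece.\<close>

lemma cod_mult_le:
  assumes "downset D"
  shows "cod D (F * G) \<le> cod D F + cod D G"
proof -
  have fD: "finite D" using assms by (simp add: downset_def)
  obtain S where S: "finite S" "card S = cod D F" "\<And>w. w \<in> cov D F S"
    using cod_obtain[OF fD, of F] by auto
  obtain T where T: "finite T" "card T = cod D G" "\<And>w. w \<in> cov D G T"
    using cod_obtain[OF fD, of G] by auto
  define U where "U = S \<union> (*) F ` T"
  have "w \<in> cov D (F * G) U" for w
  proof -
    obtain u g where u: "u \<in> mp.span S" "eqm D w (u + F * g)"
      using S(3)[of w] by (auto simp: cov_def)
    obtain v h where v: "v \<in> mp.span T" "eqm D g (v + G * h)"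
      using T(3)[of g] by (auto simp: cov_def)
    have "eqm D (u + F * g) (u + F * (v + G * h))"
      using v assms by (intro eqm_add eqm_mult_left) auto
    then have "eqm D w ((u + F * v) + (F * G) * h)"
      using eqm_trans[OF u(2)] by (simp add: algebra_simps)
    moreover have "u + F * v \<in> mp.span U"
      using u(1) mult_span[OF v(1), of F] mp.span_mono[of S U] mp.span_mono[of "(*) F ` T" U]
      unfolding U_def by (intro mp.span_add) auto
    ultimately show ?thesis using covI by blast
  qed
  then have "cod D (F * G) \<le> card U"
    using fD S T by (intro cod_le) (auto simp: U_def)
  also have "\<dots> \<le> card S + card T"
    unfolding U_def using card_Un_le[of S "(*) F ` T"] card_image_le[OF T(1), of "(*) F"] by linarith
  finally show ?thesis using S T by simp
qed

lemma cod_power_le: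
  assumes "downset D"
  shows "cod D (F ^ n) \<le> n * cod D F"
proof (induction n)
  case 0
  have "cod D (1 :: 'a mpol) \<le> card ({} :: 'a mpol set)"
  proof (rule cod_le)
    fix w :: "'a mpol" show "w \<in> cov D 1 ({} :: 'a mpol set)"
      by (rule cov_eqm_mult[of _ _ _ w]) simp
  qed (use assms in \<open>auto simp: downset_def\<close>)
  then show ?case by simp
next
  case (Suc n)
  then show ?case using cod_mult_le[OF assms, of F "F ^ n"] by simp
qed

text \<open>The \<open>p\<close>-th power of the difference is the sum of the \<open>p\<close>-th
  powers of its terms, and multiplying an exponent outside the small box by \<open>p\<close> gives
  one outside the large box.\<close>

lemma eqm_frobenius:
  fixes v w :: "'k::comm_ring_1 mpol"
  assumes p: "CHAR('k) = p" "prime p" and vw: "eqm (box d q) v w"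
  shows "eqm (box d (p * q)) (v ^ p) (w ^ p)"
proof -
  define j where "j = v - w"
  have j0: "lookup j \<alpha> = 0" if "\<alpha> \<in> box d q" for \<alpha>
    using that vw by (simp add: j_def eqm_def lookup_minus)
  have p0: "p > 0" using p prime_gt_0_nat by blast
  have "j ^ p = (\<Sum>\<alpha>\<in>Poly_Mapping.keys j. single \<alpha> (lookup j \<alpha>) ^ p)"
    using frob_sum[OF p, of "\<lambda>\<alpha>. single \<alpha> (lookup j \<alpha>)" "Poly_Mapping.keys j" 1]
    by (simp add: sum_single_keys)
  moreover have "eqm (box d (p * q)) (\<Sum>\<alpha>\<in>Poly_Mapping.keys j. single \<alpha> (lookup j \<alpha>) ^ p)
      (\<Sum>\<alpha>\<in>Poly_Mapping.keys j. 0)"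
  proof (rule eqm_sum)
    fix \<alpha> assume "\<alpha> \<in> Poly_Mapping.keys j"
    then have "\<alpha> \<notin> box d q" using j0 by (auto simp: in_keys_iff)
    then have "(\<lambda>i. p * \<alpha> i) \<notin> box d (p * q)"
      using p0 by (auto simp: bx_def mons_def)
    then show "eqm (box d (p * q)) (single \<alpha> (lookup j \<alpha>) ^ p) 0"
      unfolding single_power by (rule eqm_single_zero)
  qed
  ultimately have "eqm (box d (p * q)) (w ^ p + j ^ p) (w ^ p + 0)"
    by (intro eqm_add) auto
  moreover have "(w + j) ^ p = w ^ p + j ^ p"
    by (rule freshmans_dream) (simp_all add: CHAR_mpol p)
  ultimately show ?thesis by (simp add: j_def)
qed

text \<open>If \<open>S\<close> spans the image of \<open>F\<close> on the small box, then the elements \<open>x\<^sup>\<rho> b\<^sup>p\<close> with \<open>b \<in> S\<close> and \<open>\<rho> < p\<close>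
  span the image of \<open>F\<^sup>p\<close> on the large one.\<close>

lemma cod_frobenius:
  fixes F :: "'k::field mpol"
  assumes p: "CHAR('k) = p" "prime p"
  shows "p ^ Suc d * cod (box d q) F \<le> cod (box d (p * q)) (F ^ p)"
proof -
  let ?D = "box d (p * q)"
  have p0: "p > 0" using p prime_gt_0_nat by blast
  obtain S where S: "finite S" "card S + cod (box d q) F = card (box d q)"
    "\<And>g. F * g \<in> cov (box d q) 0 S"
    using rk_obtain[of "box d q" F] by auto
  define T where "T = (\<lambda>(\<rho>, b). xmon \<rho> * b ^ p) ` (box d p \<times> S)"
  have fT: "finite T" using S by (simp add: T_def)
  have "card T \<le> p ^ Suc d * card S"
    using card_image_le[of "box d p \<times> S" "\<lambda>(\<rho>, b). xmon \<rho> * b ^ p"] S(1)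
    by (simp add: T_def card_cartesian_product card_box)
  moreover have "F ^ p * g \<in> cov ?D 0 T" for g
  proof (rule mult_cov_UNIV[OF downset_bx])
    fix \<gamma> assume \<gamma>: "\<gamma> \<in> ?D"
    \<comment> \<open>Division with remainder of the exponents by \<open>p\<close> writes the
      monomial as a remainder part times a \<open>p\<close>-th power.\<close>
    define \<rho> where "\<rho> = (\<lambda>i. \<gamma> i mod p)"
    define \<delta> where "\<delta> = (\<lambda>i. \<gamma> i div p)"
    have \<rho>: "\<rho> \<in> box d p" using \<gamma> p0 by (auto simp: \<rho>_def bx_def mons_def)
    have "\<gamma> = \<rho> + (\<lambda>i. p * \<delta> i)" by (auto simp: \<rho>_def \<delta>_def fun_eq_iff)
    then have \<gamma>eq: "xmon \<gamma> = xmon \<rho> * (xmon \<delta> :: 'k mpol) ^ p"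
      by (simp add: single_power mult_single)
    obtain u where u: "u \<in> mp.span S" "eqm (box d q) (F * xmon \<delta>) u"
      using S(3)[of "xmon \<delta>"] by (auto simp: cov_def)
    obtain c where c: "u = (\<Sum>v\<in>S. scl (c v) v)"
      using u(1) mp.span_finite[OF S(1)] by auto
    \<comment> \<open>The \<open>p\<close>-th power is additive, so it turns a combination of
      elements of \<open>S\<close> into a combination of their \<open>p\<close>-th powers.\<close>
    have "u ^ p = (\<Sum>v\<in>S. scl (c v) v ^ p)"
      using frob_sum[OF p, of "\<lambda>v. scl (c v) v" S 1] by (simp add: c)
    also have "\<dots> = (\<Sum>v\<in>S. scl (c v ^ p) (v ^ p))"
      by (simp add: scl_def power_mult_distrib single_power zero_fun_def)
    finally have "xmon \<rho> * u ^ p = (\<Sum>v\<in>S. scl (c v ^ p) (xmon \<rho> * v ^ p))"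
      by (simp add: sum_distrib_left scl_mult_right)
    also have "\<dots> \<in> mp.span T"
      using \<rho> by (intro mp.span_sum mp.span_scale mp.span_base) (auto simp: T_def)
    finally have "xmon \<rho> * u ^ p \<in> cov ?D 0 T" by (rule span_subset_cov)
    moreover have "eqm ?D (F ^ p * xmon \<gamma>) (xmon \<rho> * u ^ p)"
      using eqm_mult_left[OF downset_bx eqm_frobenius[OF p u(2)], of "xmon \<rho>"]
      by (simp add: \<gamma>eq power_mult_distrib algebra_simps)
    ultimately show "F ^ p * xmon \<gamma> \<in> cov ?D 0 T" by (rule cov_eqm)
  qed
  then have "card ?D \<le> cod ?D (F ^ p) + card T"
    by (intro cod_ge fT) auto
  moreover have "card ?D = p ^ Suc d * (card S + cod (box d q) F)"
    by (simp add: S(2) card_box power_mult_distrib)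
  ultimately show ?thesis by (simp add: algebra_simps)
qed

text \<open>Combine \<open>cod_frobenius\<close> with \<open>cod_power_le\<close> for the exponent
  \<open>p\<close> and cancel one factor \<open>p\<close>. This makes the normalized lengths
  increase.\<close>

lemma hk_length_frobenius:
  fixes f :: "'k::field pseries"
  assumes p: "CHAR('k) = p" "prime p"
  shows "p ^ d * hk_length d f (p ^ e) \<le> hk_length d f (p ^ Suc e)"
proof -
  let ?D = "box d (p ^ Suc e)"
  define F where "F = trunc ?D f"
  have p0: "p > 0" using p prime_gt_0_nat by blast
  have "box d (p ^ e) \<subseteq> ?D"
    using p0 by (auto simp: bx_def intro: less_le_trans)
  then have F: "lookup F \<alpha> = f \<alpha>" if "\<alpha> \<in> box d (p ^ e)" for \<alpha>
    using that by (auto simp: F_def lookup_trunc)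
  have "p ^ Suc d * hk_length d f (p ^ e) = p ^ Suc d * cod (box d (p ^ e)) F"
    using hk_length_eq_cod[OF p, of d e F f] F by simp
  also have "\<dots> \<le> cod ?D (F ^ p)"
    using cod_frobenius[OF p, of d "p ^ e" F] by simp
  also have "\<dots> \<le> p * cod ?D F" by (rule cod_power_le) simp
  also have "\<dots> = p * hk_length d f (p ^ Suc e)"
    using hk_length_eq_cod[OF p, of d "Suc e" F f] by (simp add: F_def lookup_trunc)
  finally show ?thesis using p0 by simp
qed

section \<open>Upper bound for the lengths from an initial monomial\<close>

definition wt :: "nat \<Rightarrow> (nat \<Rightarrow> nat) \<Rightarrow> (nat \<Rightarrow> nat) \<Rightarrow> nat" where
  "wt d W \<alpha> = (\<Sum>i\<le>d. W i * \<alpha> i)"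

text \<open>Induction on the number of variables: among the exponents with minimal last entry choose
  weights for the other variables, then make the last variable heavy enough that a larger last entry
  always loses.\<close>

lemma exists_weight_unique_min:
  assumes "A \<subseteq> mons d" "A \<noteq> {}"
  shows "\<exists>W. \<exists>\<alpha>\<in>A. \<forall>\<beta>\<in>A. \<beta> \<noteq> \<alpha> \<longrightarrow> wt d W \<alpha> < wt d W \<beta>"
  using assms
proof (induction d arbitrary: A)
  case 0
  obtain \<alpha> where \<alpha>: "\<alpha> \<in> A" "\<And>\<beta>. \<beta> \<in> A \<Longrightarrow> \<alpha> 0 \<le> \<beta> 0"
    using 0 ex_has_least_nat[of "\<lambda>\<beta>. \<beta> \<in> A" _ "\<lambda>\<beta>. \<beta> 0"] by blast
  have "\<alpha> 0 \<noteq> \<beta> 0" if "\<beta> \<in> A" "\<beta> \<noteq> \<alpha>" for \<beta>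
  proof
    assume eq: "\<alpha> 0 = \<beta> 0"
    have "\<alpha> \<in> mons 0" "\<beta> \<in> mons 0" using 0(1) \<alpha>(1) that(1) by auto
    then have "\<beta> i = \<alpha> i" for i
      using eq by (cases "i = 0") (auto simp: mons_def)
    then show False using that by auto
  qed
  then have "\<forall>\<beta>\<in>A. \<beta> \<noteq> \<alpha> \<longrightarrow> wt 0 (\<lambda>_. 1) \<alpha> < wt 0 (\<lambda>_. 1) \<beta>"
    using \<alpha>(2) by (auto simp: wt_def le_neq_implies_less)
  then show ?case using \<alpha>(1) by blast
next
  case (Suc d)
  obtain \<alpha>0 where \<alpha>0: "\<alpha>0 \<in> A" "\<And>\<beta>. \<beta> \<in> A \<Longrightarrow> \<alpha>0 (Suc d) \<le> \<beta> (Suc d)"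
    using Suc.prems ex_has_least_nat[of "\<lambda>\<beta>. \<beta> \<in> A" _ "\<lambda>\<beta>. \<beta> (Suc d)"] by blast
  define m where "m = \<alpha>0 (Suc d)"
  define A' where "A' = (\<lambda>\<beta>. \<beta>(Suc d := 0)) ` {\<beta> \<in> A. \<beta> (Suc d) = m}"
  have "\<beta>(Suc d := 0) \<in> mons d" if "\<beta> \<in> A" for \<beta>
    using Suc.prems(1) that Suc_lessI[of d] unfolding mons_def by auto
  then have "A' \<subseteq> mons d" by (auto simp: A'_def)
  moreover have "A' \<noteq> {}" using \<alpha>0 by (auto simp: A'_def m_def)
  ultimately have "\<exists>W. \<exists>\<alpha>\<in>A'. \<forall>\<beta>\<in>A'. \<beta> \<noteq> \<alpha> \<longrightarrow> wt d W \<alpha> < wt d W \<beta>"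
    by (rule Suc.IH)
  then obtain W \<alpha>' where W: "\<alpha>' \<in> A'" "\<And>\<beta>. \<beta> \<in> A' \<Longrightarrow> \<beta> \<noteq> \<alpha>' \<Longrightarrow> wt d W \<alpha>' < wt d W \<beta>"
    by metis
  then obtain \<alpha> where \<alpha>: "\<alpha> \<in> A" "\<alpha> (Suc d) = m" "\<alpha>' = \<alpha>(Suc d := 0)"
    by (auto simp: A'_def)
  \<comment> \<open>One more than the weight of \<alpha> in the earlier variables: a single extra
    unit in the last entry already outweighs those variables.\<close>
  define W' where "W' = W(Suc d := Suc (wt d W \<alpha>))"
  have wt0: "wt d W (\<beta>(Suc d := 0)) = wt d W \<beta>" for \<beta>
    by (auto simp: wt_def)
  have wtS: "wt (Suc d) W' \<beta> = wt d W \<beta> + Suc (wt d W \<alpha>) * \<beta> (Suc d)" for \<beta>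
    by (simp add: wt_def W'_def)
  have "wt (Suc d) W' \<alpha> < wt (Suc d) W' \<beta>" if \<beta>: "\<beta> \<in> A" "\<beta> \<noteq> \<alpha>" for \<beta>
  proof (cases "\<beta> (Suc d) = m")
    case True
    have "\<beta>(Suc d := 0) \<in> A'" using \<beta> True by (auto simp: A'_def)
    moreover have "\<beta>(Suc d := 0) \<noteq> \<alpha>'"
      using \<beta>(2) True \<alpha> by (metis fun_upd_idem_iff fun_upd_upd)
    ultimately have "wt d W \<alpha>' < wt d W (\<beta>(Suc d := 0))" by (rule W(2))
    then show ?thesis using True \<alpha> by (simp add: wtS wt0)
  next
    case False
    then have "Suc m \<le> \<beta> (Suc d)" using \<alpha>0(2)[OF \<beta>(1)] by (simp add: m_def)
    then have "Suc (wt d W \<alpha>) * Suc m \<le> Suc (wt d W \<alpha>) * \<beta> (Suc d)" by (rule mult_le_mono2)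
    then show ?thesis using \<alpha> by (simp add: wtS)
  qed
  then show ?case using \<alpha>(1) by blast
qed

lemma lookup_mult_xmon:
  "lookup (F * xmon \<gamma>) \<delta> = (if \<gamma> \<le> \<delta> then lookup F (\<delta> - \<gamma>) else (0 :: 'k::comm_ring_1))"
proof -
  have "lookup (F * xmon \<gamma>) \<delta> = lookup (xmon \<gamma> * F) \<delta>" by (simp add: mult.commute)
  also have "\<dots> = (\<Sum>l. (\<Sum>q. lookup F q when \<delta> = l + q) when l = \<gamma>)"
    unfolding lookup_mult
    by (rule Sum_any.cong) (auto simp: lookup_single when_def)
  also have "\<dots> = (\<Sum>q. lookup F q when \<delta> = \<gamma> + q)" by simp
  finally show ?thesis by (simp only: Sum_any_shift) (simp add: when_def)
qed

lemma wt_add: "wt d W (\<alpha> + \<beta>) = wt d W \<alpha> + wt d W \<beta>"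
  by (simp add: wt_def algebra_simps sum.distrib)

text \<open>The monomials not divisible by the initial monomial of \<open>F\<close> cover
  everything. A divisible monomial is, up to a unit factor, the lowest term of a multiple of
  \<open>F\<close>, hence congruent to a combination of monomials of larger weight; weights in the
  box are bounded, so this rewriting stops.\<close>

lemma cod_le_card_not_ge:
  fixes F :: "'k::field mpol"
  assumes \<alpha>: "lookup F \<alpha> \<noteq> 0"
    and min: "\<And>\<beta>. \<beta> \<in> box d q \<Longrightarrow> lookup F \<beta> \<noteq> 0 \<Longrightarrow> \<beta> \<noteq> \<alpha> \<Longrightarrow> wt d W \<alpha> < wt d W \<beta>"
  shows "cod (box d q) F \<le> card {\<beta> \<in> box d q. \<not> \<alpha> \<le> \<beta>}"
proof -
  let ?D = "box d q"
  define S where "S = (xmon ` {\<beta> \<in> ?D. \<not> \<alpha> \<le> \<beta>} :: 'k mpol set)"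
  define M where "M = Max (wt d W ` ?D)"
  have M: "wt d W \<beta> \<le> M" if "\<beta> \<in> ?D" for \<beta> using that by (simp add: M_def)
  have "xmon \<beta> \<in> cov ?D F S" if "\<beta> \<in> ?D" for \<beta>
    using that
  proof (induction "M - wt d W \<beta>" arbitrary: \<beta> rule: less_induct)
    case less
    show ?case
    proof (cases "\<alpha> \<le> \<beta>")
      case False
      then show ?thesis using less.prems
        by (intro span_subset_cov mp.span_base) (auto simp: S_def)
    next
      case True
      define \<gamma> where "\<gamma> = \<beta> - \<alpha>"
      have \<beta>: "\<beta> = \<alpha> + \<gamma>" using True by (auto simp: \<gamma>_def fun_eq_iff le_fun_def)
      define G where "G = F * xmon \<gamma>"
      have G\<beta>: "lookup G \<beta> = lookup F \<alpha>"
        by (auto simp: G_def lookup_mult_xmon \<beta> le_fun_def fun_diff_def)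
      have tm: "scl (lookup G \<delta>) (xmon \<delta>) \<in> cov ?D F S" if \<delta>: "\<delta> \<in> ?D - {\<beta>}" for \<delta>
      proof (cases "lookup G \<delta> = 0")
        case True
        then show ?thesis using mp.subspace_0[OF subspace_cov[of ?D F S]] by simp
      next
        case False
        then have le: "\<gamma> \<le> \<delta>" and nz: "lookup F (\<delta> - \<gamma>) \<noteq> 0"
          by (auto simp: G_def lookup_mult_xmon split: if_splits)
        have eq: "\<delta> = (\<delta> - \<gamma>) + \<gamma>" using le by (auto simp: fun_eq_iff le_fun_def)
        have ne: "\<delta> - \<gamma> \<noteq> \<alpha>" using eq \<delta> \<beta> by auto
        have "\<delta> - \<gamma> \<in> ?D" using downset_bx[of d "\<lambda>_. q"] \<delta>
          unfolding downset_def by (auto simp: le_fun_def)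
        then have "wt d W \<alpha> < wt d W (\<delta> - \<gamma>)" using nz ne by (intro min)
        then have "wt d W \<beta> < wt d W \<delta>"
          using wt_add[of d W "\<delta> - \<gamma>" \<gamma>] by (simp add: \<beta> wt_add flip: eq)
        then have "xmon \<delta> \<in> cov ?D F S"
          using \<delta> M[of \<delta>] by (intro less.hyps) auto
        then show ?thesis using mp.subspace_scale[OF subspace_cov] by blast
      qed
      have "eqm ?D G (\<Sum>\<delta>\<in>?D. scl (lookup G \<delta>) (xmon \<delta>))"
        by (rule eqm_sym) (simp add: scl_xmon eqm_trunc flip: trunc_def)
      also have "(\<Sum>\<delta>\<in>?D. scl (lookup G \<delta>) (xmon \<delta>)) =
          scl (lookup F \<alpha>) (xmon \<beta>) + (\<Sum>\<delta>\<in>?D - {\<beta>}. scl (lookup G \<delta>) (xmon \<delta>))"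
        using less.prems by (subst sum.remove[of _ \<beta>]) (auto simp: G\<beta>)
      finally have "eqm ?D (scl (lookup F \<alpha>) (xmon \<beta>)) (G - (\<Sum>\<delta>\<in>?D - {\<beta>}. scl (lookup G \<delta>) (xmon \<delta>)))"
        by (auto simp: eqm_def lookup_add lookup_minus)
      moreover have "G - (\<Sum>\<delta>\<in>?D - {\<beta>}. scl (lookup G \<delta>) (xmon \<delta>)) \<in> cov ?D F S"
        using tm by (intro mp.subspace_diff[OF subspace_cov] mp.subspace_sum[OF subspace_cov])
          (auto simp: G_def mult_in_cov)
      ultimately have "scl (lookup F \<alpha>) (xmon \<beta>) \<in> cov ?D F S" using cov_eqm by blast
      then have "scl (inverse (lookup F \<alpha>)) (scl (lookup F \<alpha>) (xmon \<beta>)) \<in> cov ?D F S"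
        by (rule mp.subspace_scale[OF subspace_cov])
      then show ?thesis using \<alpha> by simp
    qed
  qed
  then have "w \<in> cov ?D F S" for w by (rule cov_UNIV)
  then have "cod ?D F \<le> card S" by (rule cod_le[rotated 2]) (simp_all add: S_def)
  also have "\<dots> \<le> card {\<beta> \<in> ?D. \<not> \<alpha> \<le> \<beta>}" unfolding S_def by (rule card_image_le) simp
  finally show ?thesis .
qed

text \<open>Some entry of such an exponent is below the corresponding entry of \<alpha>, which puts
  it in one of \<open>d + 1\<close> slabs.\<close>

lemma card_not_ge:
  assumes "\<alpha> \<in> mons d"
  shows "card {\<beta> \<in> box d q. \<not> \<alpha> \<le> \<beta>} \<le> (\<Sum>i\<le>d. \<alpha> i) * q ^ d"
proof -
  have "{\<beta> \<in> box d q. \<not> \<alpha> \<le> \<beta>} \<subseteq> (\<Union>i\<in>{..d}. bx d (\<lambda>j. if j = i then \<alpha> i else q))"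
  proof
    fix \<beta> assume b: "\<beta> \<in> {\<beta> \<in> box d q. \<not> \<alpha> \<le> \<beta>}"
    then obtain i where i: "\<beta> i < \<alpha> i" by (auto simp: le_fun_def not_le)
    then have "i \<le> d" using assms by (auto simp: mons_def not_less intro: ccontr)
    then show "\<beta> \<in> (\<Union>i\<in>{..d}. bx d (\<lambda>j. if j = i then \<alpha> i else q))"
      using b i by (auto simp: bx_def)
  qed
  then have "card {\<beta> \<in> box d q. \<not> \<alpha> \<le> \<beta>} \<le> card (\<Union>i\<in>{..d}. bx d (\<lambda>j. if j = i then \<alpha> i else q))"
    by (intro card_mono) auto
  also have "\<dots> \<le> (\<Sum>i\<le>d. card (bx d (\<lambda>j. if j = i then \<alpha> i else q)))"
    by (rule card_UN_le) simp
  also have "\<dots> = (\<Sum>i\<le>d. \<alpha> i * q ^ d)"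
  proof (rule sum.cong[OF refl])
    fix i assume i: "i \<in> {..d}"
    have "(\<Prod>j\<le>d. if j = i then \<alpha> i else q) = \<alpha> i * (\<Prod>j\<in>{..d} - {i}. if j = i then \<alpha> i else q)"
      using i by (subst prod.remove[of _ i]) auto
    also have "(\<Prod>j\<in>{..d} - {i}. if j = i then \<alpha> i else q) = (\<Prod>j\<in>{..d} - {i}. q)"
      by (rule prod.cong) auto
    also have "\<dots> = q ^ d" using i by simp
    finally show "card (bx d (\<lambda>j. if j = i then \<alpha> i else q)) = \<alpha> i * q ^ d"
      by (simp add: card_bx)
  qed
  finally show ?thesis by (simp add: sum_distrib_right)
qed

lemma hk_length_le:
  fixes f :: "'k::field pseries"
  assumes p: "CHAR('k) = p" "prime p" and f: "\<exists>\<alpha>\<in>mons d. f \<alpha> \<noteq> 0"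
  shows "\<exists>C. \<forall>e. hk_length d f (p ^ e) \<le> C * (p ^ e) ^ d"
proof -
  obtain W \<alpha> where \<alpha>: "\<alpha> \<in> mons d" "f \<alpha> \<noteq> 0"
    and min: "\<And>\<beta>. \<beta> \<in> mons d \<Longrightarrow> f \<beta> \<noteq> 0 \<Longrightarrow> \<beta> \<noteq> \<alpha> \<Longrightarrow> wt d W \<alpha> < wt d W \<beta>"
    using exists_weight_unique_min[of "{\<alpha> \<in> mons d. f \<alpha> \<noteq> 0}" d] f by auto
  have "hk_length d f (p ^ e) \<le> (\<Sum>i\<le>d. \<alpha> i) * (p ^ e) ^ d" for e
  proof -
    let ?D = "box d (p ^ e)"
    \<comment> \<open>For small \<open>q\<close> the initial exponent \<alpha> may lie outside the
      box; it is added so that \<open>F\<close> has a nonzero coefficient there.\<close>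
    define F where "F = trunc (insert \<alpha> ?D) f"
    have F: "lookup F \<beta> = (if \<beta> = \<alpha> \<or> \<beta> \<in> ?D then f \<beta> else 0)" for \<beta>
      by (simp add: F_def lookup_trunc)
    have "hk_length d f (p ^ e) = cod ?D F"
      by (rule hk_length_eq_cod[OF p]) (simp add: F)
    also have "\<dots> \<le> card {\<beta> \<in> ?D. \<not> \<alpha> \<le> \<beta>}"
      by (rule cod_le_card_not_ge[of _ _ _ _ W]) (auto simp: F \<alpha> bx_def intro!: min)
    also have "\<dots> \<le> (\<Sum>i\<le>d. \<alpha> i) * (p ^ e) ^ d" by (rule card_not_ge) fact
    finally show ?thesis .
  qed
  then show ?thesis by blast
qed

text \<open>The sequence increases by \<open>hk_length_frobenius\<close> and is bounded by
  \<open>hk_length_le\<close>.\<close>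

lemma hk_convergent:
  fixes f :: "'k::field pseries"
  assumes p: "CHAR('k) = p" "prime p" and f: "\<exists>\<alpha>\<in>mons d. f \<alpha> \<noteq> 0"
  shows "convergent (\<lambda>e. real (hk_length d f (p ^ e)) / real (p ^ e) ^ d)"
proof -
  let ?X = "\<lambda>e. real (hk_length d f (p ^ e)) / real (p ^ e) ^ d"
  have p0: "p > 0" using p prime_gt_0_nat by blast
  obtain C where C: "\<And>e. hk_length d f (p ^ e) \<le> C * (p ^ e) ^ d"
    using hk_length_le[OF p f] by blast
  have "?X e \<le> real C" for e
  proof -
    have "real (hk_length d f (p ^ e)) \<le> real (C * (p ^ e) ^ d)" using C of_nat_le_iff by blast
    then show ?thesis using p0 by (simp add: divide_le_eq)
  qed
  moreover have "?X e \<le> ?X (Suc e)" for e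
  proof -
    have "real (p ^ d * hk_length d f (p ^ e)) \<le> real (hk_length d f (p ^ Suc e))"
      using hk_length_frobenius[OF p] of_nat_le_iff by blast
    then show ?thesis using p0 by (simp add: divide_simps power_mult_distrib mult_ac)
  qed
  then have "incseq ?X" by (rule incseq_SucI)
  ultimately show ?thesis
    using incseq_convergent[of ?X "real C"] by (metis convergentI)
qed

section \<open>Comparison with the sum of squares\<close>

definition vars_ideal :: "nat \<Rightarrow> (nat \<Rightarrow> 'a::comm_ring_1) \<Rightarrow> 'a set" where
  "vars_ideal d x = range (\<lambda>a. \<Sum>i\<le>d. a i * x i)"

text \<open>The square of \<open>vars_ideal\<close>, presented with coefficients in
  \<open>vars_ideal\<close>: this is the form from which a Newton step reads off its
  correction.\<close>

definition sq_ideal :: "nat \<Rightarrow> (nat \<Rightarrow> 'a::comm_ring_1) \<Rightarrow> 'a set" where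
  "sq_ideal d x = {\<Sum>i\<le>d. m i * x i | m. \<forall>i. m i \<in> vars_ideal d x}"

lemma vars_ideal_add: "a \<in> vars_ideal d x \<Longrightarrow> b \<in> vars_ideal d x \<Longrightarrow> a + b \<in> vars_ideal d x"
  unfolding vars_ideal_def by (auto simp: image_iff simp flip: sum.distrib distrib_right)

lemma vars_ideal_mult: "a \<in> vars_ideal d x \<Longrightarrow> r * a \<in> vars_ideal d x"
  unfolding vars_ideal_def by (auto simp: image_iff sum_distrib_left simp flip: mult.assoc)

lemma vars_ideal_zero: "0 \<in> vars_ideal d x"
  unfolding vars_ideal_def by (rule range_eqI[of _ _ "\<lambda>_. 0"]) simp

lemma vars_ideal_var: "i \<le> d \<Longrightarrow> x i \<in> vars_ideal d x"
  unfolding vars_ideal_def by (rule range_eqI[of _ _ "\<lambda>j. if j = i then 1 else 0"])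
    (simp add: if_distrib[of "\<lambda>c. c * _"] cong: if_cong)

lemma sq_idealI: "(\<And>i. m i \<in> vars_ideal d x) \<Longrightarrow> (\<Sum>i\<le>d. m i * x i) \<in> sq_ideal d x"
  by (auto simp: sq_ideal_def)

lemma sq_ideal_add:
  assumes "a \<in> sq_ideal d x" "b \<in> sq_ideal d x"
  shows "a + b \<in> sq_ideal d x"
proof -
  obtain m n where "a = (\<Sum>i\<le>d. m i * x i)" "b = (\<Sum>i\<le>d. n i * x i)"
    "\<And>i. m i \<in> vars_ideal d x" "\<And>i. n i \<in> vars_ideal d x"
    using assms by (auto simp: sq_ideal_def)
  then show ?thesis using sq_idealI[of "\<lambda>i. m i + n i" d x]
    by (simp add: vars_ideal_add distrib_right sum.distrib)
qed

lemma sq_ideal_mult: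
  assumes "a \<in> sq_ideal d x"
  shows "r * a \<in> sq_ideal d x"
proof -
  obtain m where "a = (\<Sum>i\<le>d. m i * x i)" "\<And>i. m i \<in> vars_ideal d x"
    using assms by (auto simp: sq_ideal_def)
  then show ?thesis using sq_idealI[of "\<lambda>i. r * m i" d x]
    by (simp add: vars_ideal_mult sum_distrib_left mult.assoc)
qed

lemma sq_ideal_zero: "0 \<in> sq_ideal d x"
  using sq_idealI[of "\<lambda>_. 0" d x] by (simp add: vars_ideal_zero)

lemma sq_ideal_sum: "(\<And>i. i \<in> I \<Longrightarrow> a i \<in> sq_ideal d x) \<Longrightarrow> (\<Sum>i\<in>I. a i) \<in> sq_ideal d x"
  by (induction I rule: infinite_finite_induct) (auto simp: sq_ideal_zero sq_ideal_add)

lemma vars_ideal_times: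
  assumes "a \<in> vars_ideal d x" "b \<in> vars_ideal d x"
  shows "a * b \<in> sq_ideal d x"
proof -
  obtain c where "b = (\<Sum>i\<le>d. c i * x i)" using assms by (auto simp: vars_ideal_def)
  moreover have "(\<Sum>i\<le>d. (c i * a) * x i) \<in> sq_ideal d x"
    by (intro sq_idealI vars_ideal_mult assms)
  ultimately show ?thesis by (simp add: sum_distrib_left mult_ac)
qed

text \<open>A Morse lemma over an extra parameter \<open>s\<close>: since the deformation \<open>Q + s F\<close> is trivial at \<open>s = 0\<close>,
  Newton steps in the \<open>s\<close>-adic direction need neither square roots nor a diagonalisation.\<close>

lemma morse_newton:
  fixes x :: "nat \<Rightarrow> 'a::comm_ring_1" and h :: 'a
  assumes h: "h + h = 1" and F: "F \<in> sq_ideal d x"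
  shows "\<exists>z. (\<forall>i. z i \<in> vars_ideal d x) \<and> (\<exists>c\<in>sq_ideal d x.
    (\<Sum>i\<le>d. x i ^ 2) + s * F - (\<Sum>i\<le>d. (x i + s * z i) ^ 2) = s ^ Suc r * c)"
proof (induction r)
  case 0
  show ?case using F by (intro exI[of _ "\<lambda>_. 0"]) (auto simp: vars_ideal_zero)
next
  case (Suc r)
  then obtain z c where z: "\<And>i. z i \<in> vars_ideal d x" and "c \<in> sq_ideal d x" and
    c: "(\<Sum>i\<le>d. x i ^ 2) + s * F - (\<Sum>i\<le>d. (x i + s * z i) ^ 2) = s ^ Suc r * c" by blast
  then obtain m where m: "c = (\<Sum>i\<le>d. m i * x i)" "\<And>i. m i \<in> vars_ideal d x"
    by (auto simp: sq_ideal_def)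
  \<comment> \<open>Since \<open>h\<close> is one half, the cross term of the new correction with
    \<open>x i\<close> is \<open>s ^ Suc r * (m i * x i)\<close>; summed over \<open>i\<close> it
    cancels the current error. The remaining terms are divisible by \<open>s ^ Suc (Suc r)\<close>
    and are collected in \<open>b\<close>.\<close>
  define z' where "z' = (\<lambda>i. z i + s ^ r * h * m i)"
  define b where "b = (\<lambda>i. - 1 * (m i * z i) + (- (s ^ r * h ^ 2)) * (m i * m i))"
  define c' where "c' = (\<Sum>i\<le>d. b i)"
  have "z' i \<in> vars_ideal d x" for i
    unfolding z'_def by (intro vars_ideal_add vars_ideal_mult z m)
  moreover have "c' \<in> sq_ideal d x"
    unfolding c'_def b_def by (intro sq_ideal_sum sq_ideal_add sq_ideal_mult vars_ideal_times z m)
  moreover have "(\<Sum>i\<le>d. x i ^ 2) + s * F - (\<Sum>i\<le>d. (x i + s * z' i) ^ 2) = s ^ Suc (Suc r) * c'"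
  proof -
    have sq: "(x i + s * z' i) ^ 2 = (x i + s * z i) ^ 2 + s ^ Suc r * (m i * x i)
        - s ^ Suc (Suc r) * b i" for i
    proof -
      have "(x i + s * z' i) ^ 2 = (x i + s * z i) ^ 2 + (h + h) * (s ^ Suc r * (m i * x i))
        + (h + h) * (s ^ Suc (Suc r) * (m i * z i)) + s ^ Suc (Suc r) * (s ^ r * h ^ 2 * (m i * m i))"
        by (simp add: z'_def power2_eq_square algebra_simps)
      then show ?thesis unfolding h b_def by (simp add: algebra_simps)
    qed
    have "(\<Sum>i\<le>d. (x i + s * z' i) ^ 2) =
        (\<Sum>i\<le>d. (x i + s * z i) ^ 2) + s ^ Suc r * c - s ^ Suc (Suc r) * c'"
      unfolding sq sum_subtractf sum.distrib c'_def m(1) sum_distrib_left ..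
    then show ?thesis using c by (simp add: algebra_simps)
  qed
  ultimately show ?case by blast
qed

text \<open>Divisibility of a difference by \<open>s\<close> serves as congruence modulo
  \<open>s\<close>; this lemma and the next two make it compatible with monomials.\<close>

lemma dvd_diff_mult:
  fixes s :: "'a::comm_ring_1"
  assumes "s dvd a - b" "s dvd a' - b'"
  shows "s dvd a * a' - b * b'"
proof -
  have "a * a' - b * b' = a * (a' - b') + (a - b) * b'" by (simp add: algebra_simps)
  then show ?thesis using assms by simp
qed

lemma dvd_diff_power:
  fixes s :: "'a::comm_ring_1"
  shows "s dvd a - b \<Longrightarrow> s dvd a ^ n - b ^ n"
  by (induction n) (auto intro: dvd_diff_mult)

lemma dvd_diff_prod:
  fixes s :: "'a::comm_ring_1"
  assumes "\<And>i. i \<in> I \<Longrightarrow> s dvd a i - b i"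
  shows "s dvd (\<Prod>i\<in>I. a i) - (\<Prod>i\<in>I. b i)"
  using assms by (induction I rule: infinite_finite_induct) (auto intro: dvd_diff_mult)

section \<open>The truncated algebra with a deformation parameter\<close>

definition var :: "nat \<Rightarrow> 'k::comm_ring_1 mpol" where
  "var i = xmon (uvec i)"

definition sum_sq :: "nat \<Rightarrow> 'k::comm_ring_1 mpol" where
  "sum_sq d = (\<Sum>i\<le>d. var i ^ 2)"

text \<open>The box with one more variable \<open>var (Suc d)\<close>, the deformation parameter, truncated at \<open>N\<close>.\<close>

definition ext :: "nat \<Rightarrow> nat \<Rightarrow> nat \<Rightarrow> (nat \<Rightarrow> nat) set" where
  "ext d q N = bx (Suc d) (\<lambda>i. if i \<le> d then q else N)"

lemma downset_ext [simp]: "downset (ext d q N)"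
  and finite_ext [simp]: "finite (ext d q N)"
  by (simp_all add: ext_def)

lemma card_ext: "card (ext d q N) = N * card (box d q)"
  by (simp add: ext_def card_bx)

lemma ext_iff: "\<alpha> \<in> ext d q N \<longleftrightarrow> \<alpha> \<in> mons (Suc d) \<and> (\<forall>i\<le>d. \<alpha> i < q) \<and> \<alpha> (Suc d) < N"
  by (auto simp: ext_def bx_def le_Suc_eq)

lemma var_power: "var i ^ n = xmon (\<lambda>j. n * uvec i j)"
  by (simp add: var_def single_power)

lemma xmon_eq_prod:
  assumes "\<gamma> \<in> mons m"
  shows "xmon \<gamma> = (\<Prod>i\<le>m. var i ^ \<gamma> i)"
  using assms
proof (induction m arbitrary: \<gamma>)
  case 0
  then have "\<gamma> = (\<lambda>j. \<gamma> 0 * uvec 0 j)" by (auto simp: mons_def uvec_def fun_eq_iff)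
  then show ?case by (simp add: var_power)
next
  case (Suc m)
  have *: "\<gamma>(Suc m := 0) \<in> mons m"
    using Suc.prems Suc_lessI[of m] unfolding mons_def by auto
  have "\<gamma> = \<gamma>(Suc m := 0) + (\<lambda>j. \<gamma> (Suc m) * uvec (Suc m) j)"
    by (auto simp: uvec_def fun_eq_iff)
  then have "xmon \<gamma> = xmon (\<gamma>(Suc m := 0)) * (var (Suc m) :: 'a mpol) ^ \<gamma> (Suc m)"
    by (simp add: var_power mult_single)
  also have "(xmon (\<gamma>(Suc m := 0)) :: 'a mpol) = (\<Prod>i\<le>m. var i ^ (\<gamma>(Suc m := 0)) i)"
    by (rule Suc.IH[OF *])
  also have "\<dots> = (\<Prod>i\<le>m. var i ^ \<gamma> i)" by (rule prod.cong) auto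
  finally show ?case by simp
qed

lemma eqm_zero_power:
  fixes a b :: "'k::comm_ring_1 mpol"
  assumes "downset D" "eqm D (a ^ m) 0" "m \<le> n"
  shows "eqm D (b * a ^ n) 0"
proof -
  have "eqm D ((b * a ^ (n - m)) * a ^ m) ((b * a ^ (n - m)) * 0)"
    by (intro eqm_mult_left assms)
  moreover have "a ^ n = a ^ (n - m) * a ^ m" using assms(3) by (simp flip: power_add)
  ultimately show ?thesis by (simp add: mult.assoc)
qed

lemma last_var_power_zero: "eqm (ext d q N) (var (Suc d) ^ N) 0"
  unfolding var_power by (rule eqm_single_zero) (simp add: ext_iff uvec_def)

section \<open>Change of coordinates that is the identity modulo the parameter\<close>

locale coordinate_change =
  fixes d q N p e :: nat and z :: "nat \<Rightarrow> 'k::field mpol"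
  assumes p: "CHAR('k) = p" "prime p" and q: "q = p ^ e"
    and z: "\<And>i. z i \<in> vars_ideal d var"
begin

abbreviation "E \<equiv> ext d q N"
abbreviation "s \<equiv> (var (Suc d) :: 'k mpol)"

definition "y i = var i + s * z i"

text \<open>The image of a monomial under the substitution, which fixes the parameter
  \<open>s\<close>.\<close>

definition "Y \<gamma> = (\<Prod>i\<le>d. y i ^ \<gamma> i) * s ^ \<gamma> (Suc d)"

text \<open>The substitution \<open>var i \<mapsto> y i\<close> as a linear map; it is onto because \<open>y i\<close> and \<open>var i\<close> agree
  modulo the nilpotent \<open>s\<close>.\<close>

definition "\<Phi> w = (\<Sum>\<gamma>\<in>E. scl (lookup w \<gamma>) (Y \<gamma>))"

text \<open>Each \<open>y i\<close> lies in the ideal of the original variables, so its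
  \<open>q\<close>-th power is a combination of their \<open>q\<close>-th powers. Here it matters
  that \<open>q\<close> is a power of the characteristic.\<close>

lemma y_power_zero:
  assumes "i \<le> d"
  shows "eqm E (y i ^ q) 0"
proof -
  have "y i \<in> vars_ideal d var" unfolding y_def by (intro vars_ideal_add vars_ideal_mult z vars_ideal_var assms)
  then obtain a where a: "y i = (\<Sum>j\<le>d. a j * var j)" by (auto simp: vars_ideal_def)
  have "y i ^ q = (\<Sum>j\<le>d. a j ^ q * var j ^ q)"
    by (simp add: a q frob_sum[OF p] power_mult_distrib)
  moreover have "eqm E (\<Sum>j\<le>d. a j ^ q * var j ^ q) (\<Sum>j\<le>d. a j ^ q * 0)"
  proof (intro eqm_sum eqm_mult_left)
    fix j assume "j \<in> {..d}"
    then show "eqm E (var j ^ q) 0" unfolding var_power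
      by (intro eqm_single_zero) (auto simp: ext_iff uvec_def)
  qed simp
  ultimately show ?thesis by simp
qed

text \<open>The new coordinates satisfy the defining relations of the truncated algebra, so the
  substitution is well defined on it.\<close>

lemma Y_zero:
  assumes "\<gamma> \<in> mons (Suc d)" "\<gamma> \<notin> E"
  shows "eqm E (Y \<gamma>) 0"
proof (cases "N \<le> \<gamma> (Suc d)")
  case True
  then show ?thesis unfolding Y_def by (intro eqm_zero_power[OF downset_ext last_var_power_zero])
next
  case False
  then obtain i where i: "i \<le> d" "q \<le> \<gamma> i" using assms by (auto simp: ext_iff not_less)
  have "Y \<gamma> = ((\<Prod>j\<in>{..d} - {i}. y j ^ \<gamma> j) * s ^ \<gamma> (Suc d)) * y i ^ \<gamma> i"
    using i unfolding Y_def by (subst prod.remove[of _ i]) (auto simp: mult_ac)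
  then show ?thesis using eqm_zero_power[OF downset_ext y_power_zero[OF i(1)] i(2)] by simp
qed

lemma Y_add: "Y (\<alpha> + \<beta>) = Y \<alpha> * Y \<beta>"
  by (simp add: Y_def power_add prod.distrib mult_ac)

lemma Y_s: "Y (\<lambda>j. n * uvec (Suc d) j) = s ^ n"
  by (simp add: Y_def uvec_def)

lemma Y_y:
  assumes "i \<le> d"
  shows "Y (\<lambda>j. n * uvec i j) = y i ^ n"
proof -
  have "(\<Prod>j\<le>d. y j ^ (n * uvec i j)) = (\<Prod>j\<le>d. if j = i then y i ^ n else 1)"
    by (rule prod.cong) (auto simp: uvec_def)
  then show ?thesis using assms by (simp add: Y_def) (simp add: uvec_def)
qed

lemma xmon_Y:
  assumes "\<gamma> \<in> mons (Suc d)"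
  obtains t where "xmon \<gamma> = Y \<gamma> + s * t"
proof -
  have "s dvd (\<Prod>i\<le>d. var i ^ \<gamma> i) - (\<Prod>i\<le>d. y i ^ \<gamma> i)"
    by (intro dvd_diff_prod dvd_diff_power) (simp add: y_def)
  then have "s dvd (\<Prod>i\<le>d. var i ^ \<gamma> i) * s ^ \<gamma> (Suc d) - Y \<gamma>"
    unfolding Y_def by (intro dvd_diff_mult) auto
  then obtain t where "xmon \<gamma> - Y \<gamma> = s * t"
    by (auto simp: xmon_eq_prod[OF assms] elim: dvdE)
  then show ?thesis using that[of t] by (simp add: algebra_simps)
qed

lemma Y_in_cov: "\<gamma> \<in> mons (Suc d) \<Longrightarrow> Y \<gamma> \<in> cov E 0 (Y ` E)"
  using Y_zero[of \<gamma>] cov_eqm[OF mp.subspace_0[OF subspace_cov]]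
  by (cases "\<gamma> \<in> E") (auto intro: span_subset_cov mp.span_base)

text \<open>Descending induction on the power of \<open>s\<close>: it starts at
  \<open>s ^ N\<close>, which vanishes, and by \<open>xmon_Y\<close> replacing a monomial by its
  image costs only a multiple of the next power of \<open>s\<close>.\<close>

lemma Y_spans: "w \<in> cov E 0 (Y ` E)"
proof -
  have "s ^ (N - j) * t \<in> cov E 0 (Y ` E)" for j t
  proof (induction j arbitrary: t)
    case 0
    have "eqm E (t * s ^ N) 0" by (rule eqm_zero_power[OF downset_ext last_var_power_zero]) simp
    then show ?case using cov_eqm[OF mp.subspace_0[OF subspace_cov]] by (simp add: mult.commute)
  next
    case (Suc j)
    show ?case
    proof (cases "N \<le> j")
      \<comment> \<open>Both truncated differences are 0 here, so the induction hypothesis is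
        already the claim.\<close>
      case True
      then show ?thesis using Suc.IH by simp
    next
      case False
      then have a: "N - j = Suc (N - Suc j)" by simp
      show ?thesis
      proof (rule mult_cov_UNIV[OF downset_ext])
        fix \<gamma> assume "\<gamma> \<in> E"
        then have \<gamma>: "\<gamma> \<in> mons (Suc d)" by (simp add: ext_iff)
        then obtain t' where t': "xmon \<gamma> = Y \<gamma> + s * t'" by (rule xmon_Y)
        have "s ^ (N - Suc j) * xmon \<gamma> = Y ((\<lambda>i. (N - Suc j) * uvec (Suc d) i) + \<gamma>) + s ^ (N - j) * t'"
          by (simp only: Y_add Y_s t' a) (simp add: algebra_simps)
        also have "\<dots> \<in> cov E 0 (Y ` E)"
          using \<gamma> by (intro mp.subspace_add[OF subspace_cov] Y_in_cov Suc.IH)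
            (auto simp: mons_def uvec_def)
        finally show "s ^ (N - Suc j) * xmon \<gamma> \<in> cov E 0 (Y ` E)" .
      qed
    qed
  qed
  from this[of N w] show ?thesis by simp
qed

lemma \<Phi>_add: "\<Phi> (v + w) = \<Phi> v + \<Phi> w"
  by (simp add: \<Phi>_def lookup_add mp.scale_left_distrib sum.distrib)

lemma \<Phi>_scl: "\<Phi> (scl c v) = scl c (\<Phi> v)"
  by (simp add: \<Phi>_def mp.scale_sum_right)

lemma \<Phi>_zero: "\<Phi> 0 = 0"
  by (simp add: \<Phi>_def)

lemma \<Phi>_sum: "\<Phi> (\<Sum>i\<in>I. v i) = (\<Sum>i\<in>I. \<Phi> (v i))"
  by (induction I rule: infinite_finite_induct) (auto simp: \<Phi>_zero \<Phi>_add)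

lemma \<Phi>_cong: "eqm E v w \<Longrightarrow> \<Phi> v = \<Phi> w"
  by (auto simp: \<Phi>_def eqm_def intro!: sum.cong)

text \<open>For exponents outside \<open>E\<close> the map gives 0, and so does the substitution by
  \<open>Y_zero\<close>; hence it acts as the substitution on all monomials and respects
  products.\<close>

lemma \<Phi>_xmon:
  assumes "\<gamma> \<in> mons (Suc d)"
  shows "eqm E (\<Phi> (xmon \<gamma>)) (Y \<gamma>)"
proof -
  have "\<Phi> (xmon \<gamma>) = (\<Sum>\<beta>\<in>E. if \<beta> = \<gamma> then Y \<gamma> else 0)"
    unfolding \<Phi>_def by (rule sum.cong) (auto simp: lookup_single when_def)
  then show ?thesis using eqm_sym[OF Y_zero[OF assms]] by simp
qed

lemma \<Phi>_span:
  assumes "w \<in> mp.span S"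
  shows "\<Phi> w \<in> mp.span (\<Phi> ` S)"
  using assms
proof (rule mp.span_induct)
  show "mp.subspace {w. \<Phi> w \<in> mp.span (\<Phi> ` S)}"
    by (auto simp: mp.subspace_def \<Phi>_zero \<Phi>_add \<Phi>_scl mp.span_zero intro: mp.span_add mp.span_scale)
qed (auto intro: mp.span_base)

text \<open>The map \<open>\<Phi>\<close> sends \<open>sum_sq d * xmon \<gamma>\<close> to
  \<open>G * Y \<gamma>\<close> up to congruence, and the \<open>Y \<gamma>\<close> span. So it
  carries a spanning set of the image of \<open>sum_sq d\<close> to one of the image of
  \<open>G\<close>, and the rank cannot grow.\<close>

lemma cod_sum_sq_le:
  assumes G: "eqm E (\<Sum>i\<le>d. y i ^ 2) G"
  shows "cod E (sum_sq d :: 'k mpol) \<le> cod E G"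
proof -
  obtain S where S: "finite S" "card S + cod E (sum_sq d :: 'k mpol) = card E"
    "\<And>g. (sum_sq d :: 'k mpol) * g \<in> cov E 0 S"
    using rk_obtain[of E "sum_sq d :: 'k mpol"] by auto
  have GY: "G * Y \<gamma> \<in> cov E 0 (\<Phi> ` S)" if "\<gamma> \<in> E" for \<gamma>
  proof -
    have \<gamma>: "\<gamma> \<in> mons (Suc d)" using that by (simp add: ext_iff)
    obtain v where v: "v \<in> mp.span S" "eqm E (sum_sq d * xmon \<gamma>) v"
      using S(3)[of "xmon \<gamma>"] by (auto simp: cov_def)
    have "eqm E (G * Y \<gamma>) ((\<Sum>i\<le>d. y i ^ 2) * Y \<gamma>)"
      by (rule eqm_mult[OF downset_ext eqm_sym[OF G] eqm_refl])
    also have "(\<Sum>i\<le>d. y i ^ 2) * Y \<gamma> = (\<Sum>i\<le>d. Y ((\<lambda>j. 2 * uvec i j) + \<gamma>))"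
      unfolding sum_distrib_right by (rule sum.cong) (simp_all add: Y_add Y_y)
    also have "eqm E \<dots> (\<Sum>i\<le>d. \<Phi> (xmon ((\<lambda>j. 2 * uvec i j) + \<gamma>)))"
      using \<gamma> by (intro eqm_sum eqm_sym[OF \<Phi>_xmon]) (auto simp: mons_def uvec_def)
    also have "\<dots> = \<Phi> (sum_sq d * xmon \<gamma>)"
      by (simp add: sum_sq_def sum_distrib_right var_power mult_single \<Phi>_sum)
    also have "\<dots> = \<Phi> v" by (rule \<Phi>_cong) fact
    finally have "eqm E (G * Y \<gamma>) (\<Phi> v)" .
    moreover have "\<Phi> v \<in> cov E 0 (\<Phi> ` S)" by (intro span_subset_cov \<Phi>_span v)
    ultimately show ?thesis by (rule cov_eqm[rotated])
  qed
  have "G * w \<in> cov E 0 (\<Phi> ` S)" for w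
  proof -
    obtain u where u: "u \<in> mp.span (Y ` E)" "eqm E w u"
      using Y_spans[of w] by (auto simp: cov_def)
    from u(1) have "G * u \<in> cov E 0 (\<Phi> ` S)"
    proof (rule mp.span_induct)
      show "mp.subspace {u. G * u \<in> cov E 0 (\<Phi> ` S)}"
        using subspace_cov[of E 0 "\<Phi> ` S"] unfolding mp.subspace_def
        by (auto simp: distrib_left simp flip: scl_mult_right)
    qed (use GY in auto)
    then show ?thesis by (rule cov_eqm) (intro eqm_mult_left downset_ext u)
  qed
  then have "card E \<le> cod E G + card (\<Phi> ` S)"
    using S(1) by (intro cod_ge) auto
  then show ?thesis using S(2) card_image_le[OF S(1), of \<Phi>] by linarith
qed

end

text \<open>Polynomials not involving the deformation parameter.\<close>

definition sfree :: "nat \<Rightarrow> 'k::zero mpol \<Rightarrow> bool" where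
  "sfree d w \<longleftrightarrow> Poly_Mapping.keys w \<subseteq> mons d"

section \<open>Colengths over the box and over the box with parameter\<close>

lemma mons_add: "\<alpha> \<in> mons d \<Longrightarrow> \<beta> \<in> mons d \<Longrightarrow> \<alpha> + \<beta> \<in> mons d"
  by (simp add: mons_def)

lemma sfree_add: "sfree d v \<Longrightarrow> sfree d w \<Longrightarrow> sfree d (v + w)"
  unfolding sfree_def using Poly_Mapping.keys_add[of v w] by blast

lemma sfree_mult: "sfree d v \<Longrightarrow> sfree d w \<Longrightarrow> sfree d (v * w)"
  unfolding sfree_def using keys_mult[of v w] mons_add by blast

lemma sfree_trunc: "sfree d (trunc (box d q) a)"
  by (auto simp: sfree_def in_keys_iff lookup_trunc split: if_splits) (simp add: bx_def)

lemma sfree_xmon: "\<alpha> \<in> mons d \<Longrightarrow> sfree d (xmon \<alpha> :: 'k::comm_ring_1 mpol)"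
  by (auto simp: sfree_def)

lemma sfree_sum_sq: "sfree d (sum_sq d :: 'k::comm_ring_1 mpol)"
proof -
  have "sfree d (\<Sum>i\<in>I. var i ^ 2 :: 'k mpol)" if "finite I" "I \<subseteq> {..d}" for I
    using that
  proof (induction I rule: finite_induct)
    case (insert i I)
    then show ?case
      by (auto simp: var_power mons_def uvec_def intro!: sfree_add sfree_xmon)
  qed (simp add: sfree_def)
  then show ?thesis by (simp add: sum_sq_def)
qed

text \<open>Exponents of \<open>ext\<close> that avoid the parameter lie in the box, and at all
  others both coefficients vanish.\<close>

lemma eqm_ext_sfree:
  assumes "sfree d v" "sfree d w" "eqm (box d q) v w"
  shows "eqm (ext d q N) v w"
  unfolding eqm_def
proof
  fix \<alpha> assume \<alpha>: "\<alpha> \<in> ext d q N"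
  show "lookup v \<alpha> = lookup w \<alpha>"
  proof (cases "\<alpha> \<in> mons d")
    case True
    then have "\<alpha> \<in> box d q" using \<alpha> by (auto simp: ext_iff bx_def)
    then show ?thesis using assms(3) by (simp add: eqm_def)
  next
    case False
    then have "\<alpha> \<notin> Poly_Mapping.keys v" "\<alpha> \<notin> Poly_Mapping.keys w" using assms by (auto simp: sfree_def)
    then show ?thesis by (simp add: in_keys_iff)
  qed
qed

lemma ext_xmon_split:
  assumes "\<gamma> \<in> ext d q N"
  obtains \<beta> j where "xmon \<gamma> = (var (Suc d) :: 'k::comm_ring_1 mpol) ^ j * xmon \<beta>" "j < N" "\<beta> \<in> mons d"
proof
  have "\<gamma> = (\<lambda>j. \<gamma> (Suc d) * uvec (Suc d) j) + \<gamma>(Suc d := 0)"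
    by (auto simp: uvec_def fun_eq_iff)
  then show "xmon \<gamma> = (var (Suc d) :: 'k mpol) ^ \<gamma> (Suc d) * xmon (\<gamma>(Suc d := 0))"
    by (simp add: var_power mult_single)
  show "\<gamma> (Suc d) < N" using assms by (simp add: ext_iff)
  have "\<gamma> \<in> mons (Suc d)" using assms by (simp add: ext_iff)
  then show "\<gamma>(Suc d := 0) \<in> mons d"
    using Suc_lessI[of d] unfolding mons_def by auto
qed

text \<open>One copy of \<open>S\<close> for each power of the parameter. Truncation to the box
  removes the parameter from the elements of \<open>S\<close>, so that \<open>eqm_ext_sfree\<close>
  applies.\<close>

definition shifts :: "nat \<Rightarrow> nat \<Rightarrow> nat \<Rightarrow> 'k::comm_ring_1 mpol set \<Rightarrow> 'k mpol set" where
  "shifts d q N S = (\<lambda>(j, b). var (Suc d) ^ j * trunc (box d q) (lookup b)) ` ({..<N} \<times> S)"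

lemma finite_shifts: "finite S \<Longrightarrow> finite (shifts d q N S)"
  by (simp add: shifts_def)

lemma card_shifts: "finite S \<Longrightarrow> card (shifts d q N S) \<le> N * card S"
  unfolding shifts_def
  using card_image_le[of "{..<N} \<times> S" "\<lambda>(j, b). var (Suc d) ^ j * trunc (box d q) (lookup b)"]
  by (simp add: card_cartesian_product)

lemma span_shifts:
  assumes "u \<in> mp.span S" "j < N"
  shows "var (Suc d) ^ j * trunc (box d q) (lookup u) \<in> mp.span (shifts d q N S)"
proof -
  have "trunc (box d q) (lookup u) \<in> mp.span ((\<lambda>v. trunc (box d q) (lookup v)) ` S)"
    by (rule trunc_span) (use assms in auto)
  then have "var (Suc d) ^ j * trunc (box d q) (lookup u) \<in>
      mp.span ((*) (var (Suc d) ^ j) ` (\<lambda>v. trunc (box d q) (lookup v)) ` S)"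
    by (rule mult_span)
  moreover have "(*) (var (Suc d) ^ j) ` (\<lambda>v. trunc (box d q) (lookup v)) ` S \<subseteq> shifts d q N S"
    using assms(2) by (auto simp: shifts_def)
  ultimately show ?thesis using mp.span_mono by blast
qed

text \<open>The sum of squares does not involve the parameter, so its image is spanned by the shifts
  of a spanning set over the box, and its rank is at most \<open>N\<close> times the rank
  there.\<close>

lemma cod_ext_ge:
  "N * cod (box d q) (sum_sq d :: 'k::field mpol) \<le> cod (ext d q N) (sum_sq d :: 'k mpol)"
proof -
  let ?Q = "sum_sq d :: 'k mpol"
  obtain S where S: "finite S" "card S + cod (box d q) ?Q = card (box d q)"
    "\<And>g. ?Q * g \<in> cov (box d q) 0 S"
    using rk_obtain[of "box d q" ?Q] by auto
  have "?Q * g \<in> cov (ext d q N) 0 (shifts d q N S)" for g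
  proof (rule mult_cov_UNIV[OF downset_ext])
    fix \<gamma> assume "\<gamma> \<in> ext d q N"
    then obtain \<beta> j where \<beta>: "xmon \<gamma> = (var (Suc d) :: 'k mpol) ^ j * xmon \<beta>" "j < N" "\<beta> \<in> mons d"
      by (rule ext_xmon_split)
    obtain u where u: "u \<in> mp.span S" "eqm (box d q) (?Q * xmon \<beta>) u"
      using S(3)[of "xmon \<beta>"] by (auto simp: cov_def)
    have "eqm (ext d q N) (?Q * xmon \<beta>) (trunc (box d q) (lookup u))"
      by (intro eqm_ext_sfree sfree_mult sfree_sum_sq sfree_xmon \<beta> sfree_trunc
          eqm_trans[OF u(2)] eqm_sym[OF eqm_trunc]) auto
    then have "eqm (ext d q N) (?Q * xmon \<gamma>) (var (Suc d) ^ j * trunc (box d q) (lookup u))"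
      using eqm_mult_left[OF downset_ext, of d q N "?Q * xmon \<beta>"
          "trunc (box d q) (lookup u)" "var (Suc d) ^ j"]
      by (simp add: \<beta>(1) mult_ac)
    then show "?Q * xmon \<gamma> \<in> cov (ext d q N) 0 (shifts d q N S)"
      by (rule cov_eqm[OF span_subset_cov[OF span_shifts[OF u(1) \<beta>(2)]]])
  qed
  then have "card (ext d q N) \<le> cod (ext d q N) ?Q + card (shifts d q N S)"
    using S(1) by (intro cod_ge) (auto simp: finite_shifts)
  also have "\<dots> \<le> cod (ext d q N) ?Q + N * card S" using card_shifts[OF S(1), of d q N] by simp
  finally show ?thesis by (simp add: card_ext flip: S(2)) (simp add: algebra_simps)
qed

text \<open>Modulo \<open>Q + s F\<close> one may replace \<open>s\<^sup>j\<^sup>+\<^sup>1 F g\<close> by \<open>- s\<^sup>j Q g\<close>, so apart from \<open>s\<^sup>0\<close> each power of \<open>s\<close> contributes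
  only a complement of the image of \<open>F\<close>.\<close>

lemma cod_ext_le:
  fixes F :: "'k::field mpol"
  assumes F: "sfree d F"
  shows "cod (ext d q N) (sum_sq d + var (Suc d) * F) \<le> N * cod (box d q) F + card (box d q)"
proof -
  let ?s = "var (Suc d) :: 'k mpol"
  let ?G = "sum_sq d + ?s * F"
  let ?E = "ext d q N"
  obtain S where S: "finite S" "card S = cod (box d q) F" "\<And>w. w \<in> cov (box d q) F S"
    using cod_obtain[of "box d q" F] by auto
  define T where "T = shifts d q N S \<union> xmon ` box d q"
  have sfree_case: "?s ^ j * v \<in> cov ?E ?G T" if "j < N" "sfree d v" for j v
    using that
  proof (induction j arbitrary: v)
    case 0
    have "eqm ?E v (trunc (box d q) (lookup v))"
      by (intro eqm_ext_sfree 0 sfree_trunc eqm_sym[OF eqm_trunc]) auto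
    moreover have "trunc (box d q) (lookup v) \<in> mp.span T"
      using trunc_in_span[of "box d q" "lookup v"] mp.span_mono[of "xmon ` box d q" T]
      by (auto simp: T_def)
    ultimately show ?case using cov_eqm[OF span_subset_cov] by simp
  next
    case (Suc j)
    obtain u g where u: "u \<in> mp.span S" "eqm (box d q) v (u + F * g)"
      using S(3)[of v] by (auto simp: cov_def)
    define u' where "u' = trunc (box d q) (lookup u)"
    define g' where "g' = trunc (box d q) (lookup g)"
    have "eqm (box d q) (u + F * g) (u' + F * g')"
      unfolding u'_def g'_def by (intro eqm_add eqm_mult_left eqm_sym[OF eqm_trunc]) auto
    then have "eqm (box d q) v (u' + F * g')" using u(2) eqm_trans by blast
    then have "eqm ?E v (u' + F * g')"
      unfolding u'_def g'_def
      by (rule eqm_ext_sfree[rotated 2]) (intro Suc.prems sfree_add sfree_mult sfree_trunc F)+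
    then have "eqm ?E (?s ^ Suc j * v) (?s ^ Suc j * (u' + F * g'))"
      by (intro eqm_mult_left) auto
    \<comment> \<open>The multiple of \<open>F\<close> is traded for a multiple of \<open>?G\<close>
      and a term with one power of the parameter less, to which the induction hypothesis
      applies.\<close>
    moreover have "?s ^ Suc j * (u' + F * g') = ?s ^ Suc j * u' + ?G * (?s ^ j * g') - ?s ^ j * (sum_sq d * g')"
      by (simp add: algebra_simps)
    moreover have "?s ^ Suc j * u' + ?G * (?s ^ j * g') - ?s ^ j * (sum_sq d * g') \<in> cov ?E ?G T"
    proof (intro mp.subspace_diff[OF subspace_cov] mp.subspace_add[OF subspace_cov] mult_in_cov)
      show "?s ^ Suc j * u' \<in> cov ?E ?G T"
        using span_shifts[OF u(1) Suc.prems(1), of d q] mp.span_mono[of "shifts d q N S" T]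
        unfolding u'_def T_def by (intro span_subset_cov) auto
      show "?s ^ j * (sum_sq d * g') \<in> cov ?E ?G T"
        using Suc.prems by (intro Suc.IH sfree_mult sfree_sum_sq) (auto simp: g'_def sfree_trunc)
    qed
    ultimately show ?case using cov_eqm by metis
  qed
  have "w \<in> cov ?E ?G T" for w
  proof (rule cov_UNIV)
    fix \<gamma> assume "\<gamma> \<in> ?E"
    then obtain \<beta> j where \<beta>: "xmon \<gamma> = (var (Suc d) :: 'k mpol) ^ j * xmon \<beta>" "j < N" "\<beta> \<in> mons d"
      by (rule ext_xmon_split)
    then show "xmon \<gamma> \<in> cov ?E ?G T" using sfree_case[OF \<beta>(2) sfree_xmon[OF \<beta>(3)]] by simp
  qed
  then have "cod ?E ?G \<le> card T"
    using S(1) by (intro cod_le) (auto simp: T_def finite_shifts)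
  also have "\<dots> \<le> card (shifts d q N S) + card (xmon ` box d q :: 'k mpol set)"
    unfolding T_def by (rule card_Un_le)
  also have "\<dots> \<le> N * card S + card (box d q)"
    using card_shifts[OF S(1), of d q N] card_image_le[of "box d q" "xmon :: _ \<Rightarrow> 'k mpol"] by simp
  finally show ?thesis by (simp add: S(2))
qed

section \<open>Comparison for a fixed power of the characteristic\<close>

lemma single_in_sq_ideal:
  assumes "\<alpha> \<in> mons d" "\<not> mdeg d \<alpha> \<le> 1"
  shows "single \<alpha> c \<in> sq_ideal d (var :: nat \<Rightarrow> 'k::comm_ring_1 mpol)"
proof -
  have split: "\<exists>i\<le>d. \<exists>\<beta>\<in>mons d. \<gamma> = uvec i + \<beta> \<and> mdeg d \<gamma> = Suc (mdeg d \<beta>)"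
    if \<gamma>: "\<gamma> \<in> mons d" "mdeg d \<gamma> \<noteq> 0" for \<gamma>
  proof -
    obtain i where i: "i \<le> d" "\<gamma> i \<noteq> 0" using \<gamma>(2) by (auto simp: mdeg_def)
    have eq: "\<gamma> = uvec i + (\<gamma> - uvec i)" using i by (auto simp: uvec_def fun_eq_iff)
    have "mdeg d \<gamma> = mdeg d (uvec i) + mdeg d (\<gamma> - uvec i)"
      by (subst eq) (simp only: mdeg_def plus_fun_apply sum.distrib)
    moreover have "mdeg d (uvec i) = 1" using i by (simp add: mdeg_def uvec_def)
    moreover have "\<gamma> - uvec i \<in> mons d" using \<gamma>(1) by (auto simp: mons_def)
    ultimately show ?thesis using i eq by auto
  qed
  obtain i \<beta> where i: "i \<le> d" "\<beta> \<in> mons d" "\<alpha> = uvec i + \<beta>" "mdeg d \<alpha> = Suc (mdeg d \<beta>)"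
    using split[OF assms(1)] assms(2) by auto
  obtain j \<gamma> where j: "j \<le> d" "\<beta> = uvec j + \<gamma>"
    using split[OF i(2)] assms(2) i(4) by auto
  have "single \<alpha> c = single \<gamma> c * (var i * var j)"
    by (simp add: var_def mult_single i(3) j(2) add_ac)
  then show ?thesis
    using sq_ideal_mult[OF vars_ideal_times[OF vars_ideal_var[OF i(1)] vars_ideal_var[OF j(1)]], of "single \<gamma> c" var] by simp
qed

lemma cod_sum_sq_le_cod:
  fixes F :: "'k::field mpol"
  assumes p: "CHAR('k) = p" "prime p" "p \<noteq> 2" and q: "q = p ^ e"
    and F: "F \<in> sq_ideal d var" "sfree d F"
  shows "cod (box d q) (sum_sq d :: 'k mpol) \<le> cod (box d q) F"
proof (rule ccontr)
  assume "\<not> ?thesis"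
  then have less: "Suc (cod (box d q) F) \<le> cod (box d q) (sum_sq d :: 'k mpol)" by simp
  \<comment> \<open>Instead of a limit, one value suffices: a gap of at least 1 between the
    codimensions gives \<open>N \<le> card (box d q)\<close>.\<close>
  define N where "N = Suc (card (box d q))"
  have "(of_nat 2 :: 'k) \<noteq> 0"
    unfolding of_nat_eq_0_iff_char_dvd using p primes_dvd_imp_eq[OF _ two_is_prime_nat, of p] by auto
  then have "inverse 2 + inverse 2 = (1 :: 'k)" by (simp flip: mult_2)
  then have h: "single 0 (inverse 2) + single 0 (inverse 2) = (1 :: 'k mpol)"
    by (simp flip: single_add)
  obtain z c where z: "\<And>i. z i \<in> vars_ideal d var" and c:
    "(\<Sum>i\<le>d. var i ^ 2) + var (Suc d) * F - (\<Sum>i\<le>d. (var i + var (Suc d) * z i) ^ 2)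
      = var (Suc d) ^ Suc N * c"
    using morse_newton[OF h F(1), of "var (Suc d)" N] by blast
  \<comment> \<open>The error left by the Newton iteration is divisible by the \<open>N\<close>-th
    power of the parameter and vanishes in \<open>ext\<close>, so the sum of squares of the new
    coordinates is congruent to the deformation.\<close>
  have "eqm (ext d q N) (c * var (Suc d) ^ Suc N) 0"
    by (rule eqm_zero_power[OF downset_ext last_var_power_zero]) simp
  then have G: "eqm (ext d q N) (\<Sum>i\<le>d. (var i + var (Suc d) * z i) ^ 2) (sum_sq d + var (Suc d) * F)"
    unfolding mult.commute[of c] c[symmetric] sum_sq_def by (simp add: eqm_def lookup_minus)
  interpret coordinate_change d q N p e z
    by standard (use p q z in auto)
  have "cod (ext d q N) (sum_sq d :: 'k mpol) \<le> cod (ext d q N) (sum_sq d + var (Suc d) * F)"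
    by (rule cod_sum_sq_le) (simp add: y_def G)
  then have "N * cod (box d q) (sum_sq d :: 'k mpol) \<le> N * cod (box d q) F + card (box d q)"
    using cod_ext_ge[where ?'k = 'k, of N d q] cod_ext_le[OF F(2), of q N] by linarith
  moreover have "N * Suc (cod (box d q) F) \<le> N * cod (box d q) (sum_sq d :: 'k mpol)"
    using less by (rule mult_le_mono2)
  ultimately show False by (simp add: N_def)
qed

lemma lookup_sum_sq: "lookup (sum_sq d) \<alpha> = (quadric d \<alpha> :: 'k::comm_ring_1)"
proof -
  have inj: "(\<lambda>j. 2 * uvec i j) = \<alpha> \<longleftrightarrow> \<alpha> = (\<lambda>j. if j = i then 2 else 0)" for i
    by (auto simp: uvec_def fun_eq_iff)
  have "lookup (sum_sq d) \<alpha> = (\<Sum>i\<le>d. if \<alpha> = (\<lambda>j. if j = i then 2 else 0) then 1 else (0 :: 'k))"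
    by (simp add: sum_sq_def lookup_sum var_power lookup_single when_def inj)
  also have "\<dots> = quadric d \<alpha>"
  proof (cases "\<exists>i\<le>d. \<alpha> = (\<lambda>j. if j = i then 2 else 0)")
    case True
    then obtain i where i: "i \<le> d" "\<alpha> = (\<lambda>j. if j = i then 2 else 0)" by blast
    have "\<alpha> = (\<lambda>j. if j = i' then 2 else 0) \<longleftrightarrow> i' = i" for i'
      using i(2) by (auto simp: fun_eq_iff split: if_splits)
    then show ?thesis using i True by (simp add: quadric_def)
  qed (auto simp: quadric_def)
  finally show ?thesis .
qed

lemma hk_length_quadric_le:
  fixes f :: "'k::field pseries"
  assumes p: "CHAR('k) = p" "prime p" "p \<noteq> 2" and f: "singular_hypersurface d f"
  shows "hk_length d (quadric d :: 'k pseries) (p ^ e) \<le> hk_length d f (p ^ e)"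
proof -
  let ?D = "box d (p ^ e)"
  define F where "F = trunc ?D f"
  \<comment> \<open>Singularity removes the terms of degree at most 1; each remaining term contains
    a product of two variables.\<close>
  have "single \<alpha> (f \<alpha>) \<in> sq_ideal d var" if "\<alpha> \<in> ?D" for \<alpha>
    using f that single_in_sq_ideal[of \<alpha> d "f \<alpha>"]
    by (cases "mdeg d \<alpha> \<le> 1") (auto simp: singular_hypersurface_def bx_def sq_ideal_zero)
  then have F: "F \<in> sq_ideal d var" unfolding F_def trunc_def by (intro sq_ideal_sum)
  have "cod ?D (sum_sq d :: 'k mpol) \<le> cod ?D F"
    by (rule cod_sum_sq_le_cod[OF p refl F]) (simp add: F_def sfree_trunc)
  then show ?thesis
    using hk_length_eq_cod[OF p(1,2), of d e F f] hk_length_eq_cod[OF p(1,2), of d e "sum_sq d" "quadric d"]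
    by (simp add: F_def lookup_trunc lookup_sum_sq)
qed

theorem theorem3p2:
  fixes f :: "'k::field pseries" and d p :: nat
  assumes "uncountable (UNIV :: 'k set)"
    and "alg_closed TYPE('k)"
    and "CHAR('k) = p" and "prime p" and "p \<noteq> 2"
    and "is_hypersurface d f"
    and "singular_hypersurface d f"
  shows "e_HK p d (quadric d :: 'k pseries) \<le> e_HK p d f"
proof -
  \<comment> \<open>The exponent of the square of the first variable, witnessing that the quadric is
    not zero.\<close>
  let ?q = "\<lambda>j. if j = (0::nat) then 2 else (0::nat)"
  have "quadric d ?q \<noteq> (0 :: 'k)" by (auto simp: quadric_def)
  moreover have "?q \<in> mons d" by (simp add: mons_def)
  ultimately have "\<exists>\<alpha>\<in>mons d. quadric d \<alpha> \<noteq> (0 :: 'k)" by blast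
  note conv_q = hk_convergent[OF assms(3,4) this]
  have "\<exists>\<alpha>\<in>mons d. f \<alpha> \<noteq> 0" using assms(6) by (simp add: is_hypersurface_def)
  note conv_f = hk_convergent[OF assms(3,4) this]
  show ?thesis unfolding e_HK_def
  proof (rule LIMSEQ_le[OF convergent_LIMSEQ_iff[THEN iffD1, OF conv_q]
        convergent_LIMSEQ_iff[THEN iffD1, OF conv_f]])
    show "\<exists>N. \<forall>n\<ge>N. real (hk_length d (quadric d :: 'k pseries) (p ^ n)) / real (p ^ n) ^ d
        \<le> real (hk_length d f (p ^ n)) / real (p ^ n) ^ d"
      using hk_length_quadric_le[OF assms(3,4,5,7)]
      by (intro exI[of _ 0] allI impI divide_right_mono) auto
  qed
qed

end
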